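(* Let $a\ge 1$ and $b\ge 1$. Then, as $n\to\infty$, the empirical root distributions $\mu[p_{n,(a,b)}]$ converge weakly to the free beta prime distribution $f\mathcal{B}'_{a,b}$.
   Context: Rising factorial: $(x)_0=1$, $(x)_k=x(x+1)\cdots(x+k-1)$. For $n\in\mathbb{N}$ every complex polynomial $p$ of degree at most $n$ is written uniquely as $p(z)=\sum_{k=0}^n(-1)^k\binom nk\widetilde{\mathsf e}_k^{(n)}(p)z^{n-k}$. For $b>1$ (more generally $b\notin\{1,1-\frac1n,\dots,\frac1n\}$), $p_{n,(a,b)}$ is the monic polynomial of degree $n$ with $\widetilde{\mathsf e}_k^{(n)}(p_{n,(a,b)})=(-1)^k\frac{(-an)_k}{((b-1)n)_k}$, $k=0,\dots,n$. For $b=1$ (and $n\ge2$, $a\geq 1$), $p_{n,(a,1)}$ is the monic polynomial of degree $n-1$ defined by $p_{n,(a,1)}(z)=\lim_{b\to1}\frac{p_{n,(a,b)}(z)}{-n\,\widetilde{\mathsf e}_1^{(n)}(p_{n,(a,b)})}$. For a polynomial $p$ of degree $m\ge1$ with roots $\lambda_1,\dots,\lambda_m$ (with multiplicity), $\mu[p]=\frac1m\sum_{i=1}^m\delta_{\lambda_i}$. For a probability measure $\mu\neq\delta_0$ on $\mathbb{R}_{\ge0}$, its $S$-transform is $S_\mu(z)=\frac{1+z}{z}\Psi_\mu^{-1}(z)$, $z\in(-1+\mu(\{0\}),0)$, where $\Psi_\mu(z)=\int_0^\infty\frac{tz}{1-tz}\mu(dt)$. For $a>0$, $b\ge1$, $f\mathcal{B}'_{a,b}$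 is the unique probability measure on $\mathbb{R}_{\ge0}$ with $S$-transform $S_{f\mathcal{B}'_{a,b}}(z)=\frac{b-1-z}{a+z}$, $z\in(-\min\{a,1\},0)$. *)

theory Defs
  imports "HOL-Probability.Probability"
    "HOL-Computational_Algebra.Computational_Algebra"
begin

section \<open>The polynomials\<close>

text \<open>For a polynomial \<open>p\<close> of degree at most \<open>n\<close> and \<open>k \<le> n\<close>, the normalised coefficient in
  \<open>p(z) = (\<Sum>k\<le>n. (-1)^k * (n choose k) * etilde n k p * z^(n-k))\<close>.\<close>

definition etilde :: "nat \<Rightarrow> nat \<Rightarrow> complex poly \<Rightarrow> complex" where
  "etilde n k p = (-1) ^ k * coeff p (n - k) / of_nat (n choose k)"

definition poly_of_etilde :: "nat \<Rightarrow> (nat \<Rightarrow> complex) \<Rightarrow> complex poly" where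
  "poly_of_etilde n e = (\<Sum>k\<le>n. monom ((-1) ^ k * of_nat (n choose k) * e k) (n - k))"

lemma coeff_poly_of_etilde:
  assumes "k \<le> n"
  shows "coeff (poly_of_etilde n e) (n - k) = (-1) ^ k * of_nat (n choose k) * e k"
proof -
  have eq: "(n - j = n - k) = (j = k)" if "j \<le> n" for j
    using that assms by auto
  have "coeff (poly_of_etilde n e) (n - k) =
      (\<Sum>j\<le>n. if j = k then (-1) ^ j * of_nat (n choose j) * e j else 0)"
    unfolding poly_of_etilde_def coeff_sum coeff_monom
    by (intro sum.cong refl) (use eq in auto)
  then show ?thesis using assms by simp
qed

lemma etilde_poly_of_etilde: "k \<le> n \<Longrightarrow> etilde n k (poly_of_etilde n e) = e k"
  by (simp add: etilde_def coeff_poly_of_etilde flip: power_mult_distrib mult.assoc)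

lemma degree_poly_of_etilde_le: "degree (poly_of_etilde n e) \<le> n"
  unfolding poly_of_etilde_def
  by (intro degree_sum_le) (auto intro: order.trans[OF degree_monom_le])

lemma poly_of_etilde_unique:
  assumes "degree p \<le> n" "\<And>k. k \<le> n \<Longrightarrow> etilde n k p = e k"
  shows "p = poly_of_etilde n e"
proof (rule poly_eqI)
  fix i
  show "coeff p i = coeff (poly_of_etilde n e) i"
  proof (cases "i \<le> n")
    case True
    then have "etilde n (n - i) p = etilde n (n - i) (poly_of_etilde n e)"
      using assms(2)[of "n - i"] etilde_poly_of_etilde[of "n - i" n e] by simp
    moreover have "n choose (n - i) \<noteq> 0" by (simp add: binomial_eq_0_iff)
    ultimately show ?thesis using True by (simp add: etilde_def)
  next
    case False
    then show ?thesis
      using assms(1) degree_poly_of_etilde_le[of n e] by (simp add: coeff_eq_0)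
  qed
qed

text \<open>Meaningful for \<open>b \<notin> {1, 1 - 1/n, \<dots>, 1/n}\<close>, where no denominator vanishes.\<close>

definition hyp_poly :: "nat \<Rightarrow> real \<Rightarrow> real \<Rightarrow> complex poly" where
  "hyp_poly n a b = poly_of_etilde n (\<lambda>k. complex_of_real
     ((-1) ^ k * pochhammer (- a * real n) k / pochhammer ((b - 1) * real n) k))"

lemma lead_hyp_poly: "degree (hyp_poly n a b) = n" "lead_coeff (hyp_poly n a b) = 1"
proof -
  have c: "coeff (hyp_poly n a b) n = 1"
    using coeff_poly_of_etilde[of 0 n] by (simp add: hyp_poly_def)
  show d: "degree (hyp_poly n a b) = n"
    by (rule antisym, simp add: hyp_poly_def degree_poly_of_etilde_le)
       (rule le_degree, simp add: c)
  show "lead_coeff (hyp_poly n a b) = 1" using c d by simp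
qed

text \<open>The limit is taken over \<open>b \<noteq> 1\<close>, on both sides of \<open>1\<close>.\<close>

definition hyp_poly_at_1 :: "nat \<Rightarrow> real \<Rightarrow> complex poly" where
  "hyp_poly_at_1 n a = (THE p. degree p = n - 1 \<and> lead_coeff p = 1 \<and>
     (\<forall>z. ((\<lambda>b. poly (hyp_poly n a b) z / (- of_nat n * etilde n 1 (hyp_poly n a b)))
            \<longlongrightarrow> poly p z) (at (1::real))))"

lemma hyp_poly_at_1_explicit:
  assumes "n \<ge> 1" "a > 0"
  defines "c k \<equiv> complex_of_real
    (real (n choose k) * pochhammer (1 - a * real n) (k - 1) / (real n * fact (k - 1)))"
  defines "q \<equiv> (\<Sum>k=1..n. monom (c k) (n - k))"
  shows "hyp_poly_at_1 n a = q"
    and "degree q = n - 1 \<and> lead_coeff q = 1 \<and>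
     (\<forall>z. ((\<lambda>b. poly (hyp_poly n a b) z / (- of_nat n * etilde n 1 (hyp_poly n a b)))
            \<longlongrightarrow> poly q z) (at (1::real)))"
proof -
  let ?F = "\<lambda>z b. poly (hyp_poly n a b) z / (- of_nat n * etilde n 1 (hyp_poly n a b))"
  define r where "r k b = (if k = 0 then - (b - 1) / (a * real n)
    else real (n choose k) * (pochhammer (1 - a * real n) (k - 1)
           / pochhammer (1 + (b - 1) * real n) (k - 1)) / real n)" for k and b :: real
  have n: "real n \<noteq> 0" using assms by simp
  have coeff: "(-1) ^ k * real (n choose k) *
      ((-1) ^ k * pochhammer (- a * real n) k / pochhammer ((b - 1) * real n) k)
      / (- real n * (a / (b - 1))) = r k b" if "b \<noteq> 1" for k b
  proof (cases k)
    case 0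
    then show ?thesis using that assms n by (simp add: r_def field_simps)
  next
    case (Suc m)
    have "(-1) ^ k * (-1) ^ k = (1::real)" by (simp flip: power_mult_distrib)
    then have "(-1) ^ k * real (n choose k) *
        ((-1) ^ k * pochhammer (- a * real n) k / pochhammer ((b - 1) * real n) k)
        = real (n choose k) * (pochhammer (- a * real n) k / pochhammer ((b - 1) * real n) k)"
      by (simp add: algebra_simps)
    also have "\<dots> = real (n choose k) * ((- a * real n) / ((b - 1) * real n)
        * (pochhammer (1 - a * real n) m / pochhammer (1 + (b - 1) * real n) m))"
      by (simp add: Suc pochhammer_rec add.commute)
    also have "\<dots> / (- real n * (a / (b - 1))) = r k b"
      using that assms n unfolding r_def Suc by (simp add: divide_simps)
    finally show ?thesis .
  qed
  have etilde1: "etilde n 1 (hyp_poly n a b) = complex_of_real (a / (b - 1))" for b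
    using assms unfolding hyp_poly_def by (subst etilde_poly_of_etilde) (auto simp: divide_simps)
  have F: "?F z b = (\<Sum>k\<le>n. complex_of_real (r k b) * z ^ (n - k))" if "b \<noteq> 1" for z b
    unfolding etilde1
    unfolding hyp_poly_def poly_of_etilde_def poly_sum poly_monom sum_divide_distrib
    by (intro sum.cong refl) (simp flip: coeff[OF that])
  have r: "((\<lambda>b. r k b) \<longlongrightarrow> (if k = 0 then 0 else real (n choose k) *
      pochhammer (1 - a * real n) (k - 1) / (real n * fact (k - 1)))) (at 1)" for k
  proof (cases "k = 0")
    case True
    have "((\<lambda>b. - (b - 1) / (a * real n)) \<longlongrightarrow> - (1 - 1) / (a * real n)) (at 1)"
      using assms by (intro tendsto_intros) auto
    then show ?thesis using True by (simp add: r_def)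
  next
    case False
    have "((\<lambda>b. pochhammer (1 + (b - 1) * real n) (k - 1)) \<longlongrightarrow>
        pochhammer (1 + (1 - 1) * real n) (k - 1)) (at 1)"
      unfolding pochhammer_prod by (intro tendsto_intros)
    then have "((\<lambda>b. pochhammer (1 + (b - 1) * real n) (k - 1)) \<longlongrightarrow> fact (k - 1)) (at 1)"
      by (simp add: pochhammer_fact)
    then have "((\<lambda>b. real (n choose k) * (pochhammer (1 - a * real n) (k - 1)
           / pochhammer (1 + (b - 1) * real n) (k - 1)) / real n) \<longlongrightarrow>
        real (n choose k) * (pochhammer (1 - a * real n) (k - 1) / fact (k - 1)) / real n) (at 1)"
      using n by (intro tendsto_intros) auto
    then show ?thesis using False by (simp add: r_def mult.commute)
  qed
  have q_eq: "poly q z = (\<Sum>k\<le>n. complex_of_real (if k = 0 then 0 else real (n choose k) *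
      pochhammer (1 - a * real n) (k - 1) / (real n * fact (k - 1))) * z ^ (n - k))" for z
    unfolding q_def poly_sum poly_monom c_def
    by (rule sum.mono_neutral_cong_left) auto
  have lim: "(?F z \<longlongrightarrow> poly q z) (at 1)" for z
  proof -
    have "((\<lambda>b. \<Sum>k\<le>n. complex_of_real (r k b) * z ^ (n - k)) \<longlongrightarrow> poly q z) (at 1)"
      unfolding q_eq by (intro tendsto_intros r)
    moreover have "\<forall>\<^sub>F b in at 1. (\<Sum>k\<le>n. complex_of_real (r k b) * z ^ (n - k)) = ?F z b"
      using F by (auto simp: eventually_at_filter)
    ultimately show ?thesis by (rule Lim_transform_eventually)
  qed
  have "coeff q (n - 1) = (\<Sum>k=1..n. if k = 1 then c k else 0)"
    unfolding q_def coeff_sum coeff_monom by (intro sum.cong) auto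
  also have "\<dots> = 1" using assms(1) n by (simp add: c_def)
  finally have q1: "coeff q (n - 1) = 1" .
  have "degree q \<le> n - 1"
    unfolding q_def by (intro degree_sum_le) (auto intro!: order.trans[OF degree_monom_le])
  moreover have "n - 1 \<le> degree q" by (rule le_degree) (use q1 in simp)
  ultimately have dq: "degree q = n - 1" by simp
  show spec: "degree q = n - 1 \<and> lead_coeff q = 1 \<and> (\<forall>z. (?F z \<longlongrightarrow> poly q z) (at 1))"
    using dq q1 lim by auto
  show "hyp_poly_at_1 n a = q"
    unfolding hyp_poly_at_1_def
  proof (rule the_equality, rule spec)
    fix p assume "degree p = n - 1 \<and> lead_coeff p = 1 \<and> (\<forall>z. (?F z \<longlongrightarrow> poly p z) (at 1))"
    then have "poly p z = poly q z" for z
      using lim[of z] tendsto_unique[of "at (1::real)"] by (metis at_neq_bot)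
    then show "p = q" by (simp add: poly_eq_poly_eq_iff[symmetric] fun_eq_iff)
  qed
qed

definition beta_prime_poly :: "nat \<Rightarrow> real \<Rightarrow> real \<Rightarrow> complex poly" where
  "beta_prime_poly n a b = (if b = 1 then hyp_poly_at_1 n a else hyp_poly n a b)"

section \<open>Empirical root distributions and weak convergence\<close>

text \<open>\<^const>\<open>proots\<close> lists the roots with multiplicity; over the complex numbers there are
  \<^term>\<open>degree p\<close> of them. No claim that the roots are real is built in, so this is a
  Borel measure on the complex plane.\<close>

definition root_distribution :: "complex poly \<Rightarrow> complex measure" where
  "root_distribution p = distr (measure_pmf (pmf_of_multiset (proots p))) borel (\<lambda>x. x)"

text \<open>The library's \<^const>\<open>weak_conv_m\<close> is restricted to measures on the real line.\<close>

definition weakly_converges ::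
    "(nat \<Rightarrow> 'a::topological_space measure) \<Rightarrow> 'a measure \<Rightarrow> bool" where
  "weakly_converges M_seq M \<longleftrightarrow>
     (\<forall>f :: 'a \<Rightarrow> real. continuous_on UNIV f \<longrightarrow> bounded (range f) \<longrightarrow>
        (\<lambda>n. integral\<^sup>L (M_seq n) f) \<longlonglongrightarrow> integral\<^sup>L M f)"

section \<open>The S-transform and the free beta prime distribution\<close>

definition Psi_transform :: "real measure \<Rightarrow> real \<Rightarrow> real" where
  "Psi_transform \<mu> z = (LINT t|\<mu>. t * z / (1 - t * z))"

text \<open>For \<open>\<mu>\<close> on the nonnegative reals other than the point mass at \<open>0\<close>,
  \<^term>\<open>Psi_transform \<mu>\<close> maps the negative half-line bijectively onto
  \<open>(-1 + \<mu>{0}, 0)\<close>.\<close>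

definition S_transform :: "real measure \<Rightarrow> real \<Rightarrow> real" where
  "S_transform \<mu> z = (1 + z) / z * the_inv_into {..<0} (Psi_transform \<mu>) z"

text \<open>The S-transform is a function on \<open>(-1 + \<mu>{0}, 0)\<close>; that this domain is
  \<open>(- min a 1, 0)\<close> is part of prescribing it.\<close>

definition is_free_beta_prime :: "real \<Rightarrow> real \<Rightarrow> real measure \<Rightarrow> bool" where
  "is_free_beta_prime a b \<mu> \<longleftrightarrow>
     prob_space \<mu> \<and> sets \<mu> = sets borel \<and> (AE t in \<mu>. 0 \<le> t) \<and> \<mu> \<noteq> return borel 0 \<and>
     -1 + measure \<mu> {0} = - min a 1 \<and>
     (\<forall>z\<in>{- min a 1<..<0}. S_transform \<mu> z = (b - 1 - z) / (a + z))"

definition free_beta_prime :: "real \<Rightarrow> real \<Rightarrow> real measure" where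
  "free_beta_prime a b = (THE \<mu>. is_free_beta_prime a b \<mu>)"

end

theory Submission
  imports Defs
begin

text \<open>The polynomials are reversed hypergeometric (Jacobi) polynomials. A contiguity relation expresses
  the one of degree \<open>m + 1\<close> through that of degree \<open>m\<close> and its derivative; written as a partial fraction
  all of whose residues have the same sign, it shows inductively that all roots are positive reals.
  The hypergeometric differential equation, divided by the polynomial and by \<open>m\<^sup>2\<close>, is a Riccati equation
  for the mean \<open>u\<close> of \<open>x / (x + \<lambda>)\<close> over the roots \<open>\<lambda>\<close> whose derivative term is \<open>O(1/m)\<close>, so \<open>u\<close> tends
  to the root in \<open>(0, 1)\<close> of \<open>x (1 - u) (b - u) = u (a - 1 + u)\<close>. Since \<open>\<Psi>(-1/x) = u - 1\<close>, this quadratic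
  equation is the prescription of the S-transform. Tightness then yields the existence of the free
  beta prime distribution as a limit point, and uniqueness of the Stieltjes transform gives
  convergence of the whole sequence.\<close>

section \<open>The polynomials: contiguity and differential equation\<close>

text \<open>A common form of both cases of the statement: \<open>b > 1\<close> has \<open>(m, A, B) = (n, a n, (b - 1) n)\<close> and
  \<open>b = 1\<close> has \<open>(n - 1, a n - 1, 2)\<close>.\<close>

definition jac :: "nat \<Rightarrow> real \<Rightarrow> real \<Rightarrow> complex poly" where
  "jac m A B = poly_of_etilde m (\<lambda>k. complex_of_real
     ((-1) ^ k * pochhammer (- A) k / pochhammer B k))"

text \<open>The two signs in \<open>jac\<close> and \<open>poly_of_etilde\<close> cancel, so this is
  the plain coefficient of \<open>z^(m-k)\<close>.\<close>

definition jac_coeff :: "nat \<Rightarrow> real \<Rightarrow> real \<Rightarrow> nat \<Rightarrow> real" where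
  "jac_coeff m A B k = real (m choose k) * pochhammer (- A) k / pochhammer B k"

lemma coeff_jac: "k \<le> m \<Longrightarrow> coeff (jac m A B) (m - k) = complex_of_real (jac_coeff m A B k)"
proof -
  assume "k \<le> m"
  have "(-1) ^ k * ((-1) ^ k * x) = x" for x :: complex
    by (simp flip: mult.assoc power_mult_distrib)
  then show ?thesis
    using \<open>k \<le> m\<close> by (simp add: jac_def jac_coeff_def coeff_poly_of_etilde algebra_simps)
qed

lemma degree_jac: "degree (jac m A B) = m"
proof (rule antisym)
  show "degree (jac m A B) \<le> m" by (simp add: jac_def degree_poly_of_etilde_le)
  show "m \<le> degree (jac m A B)"
    using coeff_jac[of 0 m] by (intro le_degree) (simp add: jac_coeff_def)
qed

lemma coeff_jac': "coeff (jac m A B) j =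
   (if j \<le> m then complex_of_real (jac_coeff m A B (m - j)) else 0)"
  using coeff_jac[of "m - j" m A B] by (auto simp: coeff_eq_0 degree_jac)

lemma jac_nonzero: "jac m A B \<noteq> 0"
  using coeff_jac[of 0 m A B] by (auto simp: jac_coeff_def)

text \<open>With real subtraction this absorption identity holds for every \<open>k\<close>; beyond
  \<open>m\<close> both sides vanish.\<close>

lemma choose_Suc_mult: "real (m choose Suc k) * real (Suc k) = real (m choose k) * (real m - real k)"
proof (cases "k \<le> m")
  case True
  have "(m choose Suc k) * Suc k = (m choose k) * (m - k)"
    using binomial_absorption[of k m] binomial_absorb_comp[of m k] by (simp add: mult.commute)
  then show ?thesis using True by (metis of_nat_diff of_nat_mult)
qed (simp add: binomial_eq_0)

text \<open>The ratio of consecutive hypergeometric terms with denominators cleared; the factor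
  \<open>real m - real k\<close> ends the series at \<open>k = m\<close>.\<close>

lemma jac_coeff_Suc:
  assumes "B > 0"
  shows "jac_coeff m A B (Suc k) * (real (Suc k) * (B + real k))
    = - ((real m - real k) * (A - real k)) * jac_coeff m A B k"
proof -
  have p: "pochhammer B k > 0" using assms by (simp add: pochhammer_pos)
  have "jac_coeff m A B (Suc k) * (real (Suc k) * (B + real k))
     = (real (m choose Suc k) * real (Suc k)) * pochhammer (-A) k * (- A + real k) / pochhammer B k"
    using assms p by (simp add: jac_coeff_def pochhammer_Suc divide_simps)
  also have "\<dots> = - ((real m - real k) * (A - real k)) * jac_coeff m A B k"
    unfolding choose_Suc_mult jac_coeff_def by (simp add: field_simps)
  finally show ?thesis .
qed

text \<open>The term ratio reindexed by the power \<open>j = m - k\<close>; it is the coefficient of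
  \<open>z^j\<close> in the differential equation \<open>jac_ode\<close>.\<close>

lemma coeff_jac_rec:
  assumes "B > 0"
  shows "of_real ((real m - real j) * (B + real m - 1 - real j)) * coeff (jac m A B) j
       + of_real (real (Suc j) * (A - real m + 1 + real j)) * coeff (jac m A B) (Suc j) = 0"
proof (cases "j < m")
  case True
  then have m: "m - j = Suc (m - Suc j)" by simp
  have "(real m - real j) * (B + real m - 1 - real j) * jac_coeff m A B (m - j)
       + real (Suc j) * (A - real m + 1 + real j) * jac_coeff m A B (m - Suc j) = 0"
    using jac_coeff_Suc[OF assms, of m A "m - Suc j"] True unfolding m[symmetric]
    by (simp add: of_nat_diff algebra_simps)
  then show ?thesis using True
    by (simp add: coeff_jac' flip: of_real_mult of_real_add)
next
  case False
  then show ?thesis by (cases "j = m") (simp_all add: coeff_jac')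
qed

section \<open>Differential equation and contiguity relation, compared coefficient by
  coefficient\<close>

lemma coeff_times_pderiv:
  "coeff ([:0, 1, 1:] * pderiv p) (Suc j) =
     of_nat (Suc j) * coeff p (Suc j) + of_nat j * coeff p j"
  "coeff ([:0, 1, 1:] * pderiv (pderiv p)) j =
     of_nat j * of_nat (Suc j) * coeff p (Suc j) + of_nat j * (of_nat j - 1) * coeff p j"
  "coeff ([:u, v:] * pderiv p) j = u * of_nat (Suc j) * coeff p (Suc j) + v * of_nat j * coeff p j"
  for p :: "'a::idom poly"
proof -
  show "coeff ([:0, 1, 1:] * pderiv p) (Suc j) =
     of_nat (Suc j) * coeff p (Suc j) + of_nat j * coeff p j"
    by (cases j) (auto simp: coeff_pCons coeff_pderiv)
  show "coeff ([:0, 1, 1:] * pderiv (pderiv p)) j =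
     of_nat j * of_nat (Suc j) * coeff p (Suc j) + of_nat j * (of_nat j - 1) * coeff p j"
    by (cases j; cases "j - 1") (auto simp: coeff_pCons coeff_pderiv)
  show "coeff ([:u, v:] * pderiv p) j = u * of_nat (Suc j) * coeff p (Suc j) + v * of_nat j * coeff p j"
    by (cases j) (auto simp: coeff_pCons coeff_pderiv)
qed

lemma jac_ode:
  assumes "B > 0"
  shows "[:0, 1, 1:] * pderiv (pderiv (jac m A B))
     + [:of_real (1 + A - real m), - of_real (B + 2 * real m - 2):] * pderiv (jac m A B)
     + smult (of_real (real m * (B + real m - 1))) (jac m A B) = 0"
proof (rule poly_eqI)
  fix j
  define c d where "c = coeff (jac m A B) j" and "d = coeff (jac m A B) (Suc j)"
  show "coeff ([:0, 1, 1:] * pderiv (pderiv (jac m A B))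
     + [:of_real (1 + A - real m), - of_real (B + 2 * real m - 2):] * pderiv (jac m A B)
     + smult (of_real (real m * (B + real m - 1))) (jac m A B)) j = coeff 0 j"
    using coeff_jac_rec[OF assms, of m j A]
    unfolding coeff_add coeff_smult coeff_times_pderiv(2,3) coeff_0 c_def[symmetric] d_def[symmetric]
    by (simp add: algebra_simps)
qed

text \<open>The move raises the degree and keeps \<open>A - m\<close> and \<open>B + m\<close>
  fixed, so the condition \<open>m <= A\<close> survives an induction on the degree;
  \<open>B > 1\<close> keeps the new denominator parameter positive.\<close>

lemma jac_step:
  assumes "B > 1"
  shows "smult (of_real (B - 1)) (jac (Suc m) (A + 1) (B - 1)) =
     [:- of_real (A + 1), of_real (B - 1 + real m):] * jac m A B - [:0, 1, 1:] * pderiv (jac m A B)"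
proof (rule poly_eqI)
  \<comment> \<open>Comparison at the power \<open>m - i\<close>: Pascal's rule splits the new
    binomial coefficient, and every term becomes a multiple of \<open>P\<close>.\<close>
  have key: "(B - 1) * jac_coeff (Suc m) (A + 1) (B - 1) (Suc i) =
    - (A + real m + 1 - real i) * jac_coeff m A B i + (B + real i) * jac_coeff m A B (Suc i)" for i
  proof -
    define P where "P = pochhammer (-A) i / pochhammer B i"
    have p: "pochhammer B i > 0" using assms by (simp add: pochhammer_pos)
    have 1: "(B - 1) * jac_coeff (Suc m) (A + 1) (B - 1) (Suc i)
        = (real (m choose i) + real (m choose Suc i)) * (- (A + 1)) * P"
      using assms p by (simp add: jac_coeff_def P_def pochhammer_rec add.commute divide_simps algebra_simps)
    have 2: "jac_coeff m A B i = real (m choose i) * P"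
      by (simp add: jac_coeff_def P_def)
    have 3: "(B + real i) * jac_coeff m A B (Suc i) = real (m choose Suc i) * (real i - A) * P"
      using assms p by (simp add: jac_coeff_def P_def pochhammer_Suc divide_simps)
    have 4: "real (m choose Suc i) * real i = real (m choose i) * (real m - real i) - real (m choose Suc i)"
      using choose_Suc_mult[of m i] by (simp add: algebra_simps)
    have "(real (m choose i) + real (m choose Suc i)) * (- (A + 1)) 
       = - (A + real m + 1 - real i) * real (m choose i) + real (m choose Suc i) * (real i - A)"
      using 4 by (simp add: algebra_simps)
    then show ?thesis unfolding 1 2 3 by (simp only: distrib_right mult.assoc[symmetric])
  qed
  fix j
  show "coeff (smult (of_real (B - 1)) (jac (Suc m) (A + 1) (B - 1))) j =
    coeff ([:- of_real (A + 1), of_real (B - 1 + real m):] * jac m A B - [:0, 1, 1:] * pderiv (jac m A B)) j"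
  proof (cases j)
    case 0
    \<comment> \<open>The constant coefficient is \<open>key\<close> at \<open>i = m\<close>, where
      the term with \<open>m choose Suc m\<close> vanishes.\<close>
    show ?thesis
      using arg_cong[OF key[of m], of complex_of_real]
      by (simp add: 0 coeff_jac' coeff_pCons jac_coeff_def binomial_eq_0 algebra_simps)
  next
    case (Suc l)
    define c d where "c = coeff (jac m A B) j" and "d = coeff (jac m A B) l"
    have *: "coeff ([:- of_real (A + 1), of_real (B - 1 + real m):] * jac m A B) j
       = - of_real (A + 1) * c + of_real (B - 1 + real m) * d"
      unfolding Suc c_def d_def by (simp add: coeff_pCons)
    have R: "coeff ([:- of_real (A + 1), of_real (B - 1 + real m):] * jac m A B
         - [:0, 1, 1:] * pderiv (jac m A B)) j
       = - of_real (A + 1 + real j) * coeff (jac m A B) j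
         + of_real (B - 1 + real m - real l) * coeff (jac m A B) l"
      unfolding coeff_diff * unfolding Suc coeff_times_pderiv(1)
      unfolding Suc[symmetric] c_def[symmetric] d_def[symmetric]
      by (simp add: algebra_simps)
    \<comment> \<open>Above the leading power everything vanishes, \<open>l = m\<close> is the
      leading power itself, and the remaining powers are \<open>key\<close> at
      \<open>i = m - j\<close>.\<close>
    consider "l > m" | "l = m" | "l < m" by linarith
    then show ?thesis
    proof cases
      case 1 then show ?thesis unfolding R by (simp add: coeff_jac' Suc)
    next
      case 2 then show ?thesis unfolding R by (simp add: coeff_jac' Suc jac_coeff_def)
    next
      case 3
      then have e: "m - l = Suc (m - Suc l)" and "real (m - Suc l) = real m - real l - 1" by auto
      then have "(B - 1) * jac_coeff (Suc m) (A + 1) (B - 1) (m - l) =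
        - (A + 1 + real j) * jac_coeff m A B (m - j) + (B - 1 + real m - real l) * jac_coeff m A B (m - l)"
        using key[of "m - Suc l"] 3 by (simp add: Suc algebra_simps)
      from arg_cong[OF this, of complex_of_real] show ?thesis unfolding R using 3
        by (simp add: coeff_jac' Suc)
    qed
  qed
qed

text \<open>Logarithmic differentiation: \<open>p'/p = S\<close> and
  \<open>p''/p = S^2 + S'\<close>, where \<open>S' = - T\<close>. Adding one linear factor at a time
  with the product rule takes care of repeated roots.\<close>

lemma poly_pderiv_linear_factors:
  fixes z :: "'a::field_char_0"
  assumes "z \<notin># M"
  shows "poly (pderiv (\<Prod>x\<in>#M. [:-x, 1:])) z = poly (\<Prod>x\<in>#M. [:-x, 1:]) z * (\<Sum>x\<in>#M. 1 / (z - x))"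
    and "poly (pderiv (pderiv (\<Prod>x\<in>#M. [:-x, 1:]))) z = poly (\<Prod>x\<in>#M. [:-x, 1:]) z *
           ((\<Sum>x\<in>#M. 1 / (z - x))\<^sup>2 - (\<Sum>x\<in>#M. 1 / (z - x)\<^sup>2))"
  using assms
proof (induction M)
  case (add y M)
  {
    case 1
    then have "z - y \<noteq> 0" by auto
    define q S where "q = (\<Prod>x\<in>#M. [:-x, 1:])" and "S = (\<Sum>x\<in>#M. 1 / (z - x))"
    have "poly (pderiv ([:-y, 1:] * q)) z = poly q z + (z - y) * poly (pderiv q) z"
      by (simp only: pderiv_mult) (simp add: pderiv_pCons algebra_simps)
    also have "\<dots> = poly q z + (z - y) * (poly q z * S)"
      using 1 add.IH by (simp add: q_def S_def)
    also have "\<dots> = poly ([:-y, 1:] * q) z * (1 / (z - y) + S)"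
      using \<open>z - y \<noteq> 0\<close> by (simp add: field_simps)
    finally show ?case by (simp only: image_mset_add_mset prod_mset.add_mset sum_mset.add_mset q_def S_def)
  next
    case 2
    then have "z - y \<noteq> 0" by auto
    define q S T where "q = (\<Prod>x\<in>#M. [:-x, 1:])" and "S = (\<Sum>x\<in>#M. 1 / (z - x))"
      and "T = (\<Sum>x\<in>#M. 1 / (z - x)\<^sup>2)"
    have "pderiv (pderiv ([:-y, 1:] * q)) = [:-y, 1:] * pderiv (pderiv q) + 2 * pderiv q"
      by (simp only: pderiv_mult pderiv_add) (simp add: pderiv_pCons pderiv_1)
    then have "poly (pderiv (pderiv ([:-y, 1:] * q))) z =
      poly ([:-y, 1:] * pderiv (pderiv q) + 2 * pderiv q) z"
      by (simp only:)
    also have "\<dots> = 2 * poly (pderiv q) z + (z - y) * poly (pderiv (pderiv q)) z"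
      by (simp add: poly_numeral algebra_simps)
    also have "\<dots> = 2 * (poly q z * S) + (z - y) * (poly q z * (S\<^sup>2 - T))"
      using 2 add.IH by (simp add: q_def S_def T_def)
    also have "\<dots> = poly ([:-y, 1:] * q) z * ((1 / (z - y) + S)\<^sup>2 - (1 / (z - y)\<^sup>2 + T))"
    proof -
      have "2 * (c * S) + w * (c * (S\<^sup>2 - T)) = (w * c) * ((1 / w + S)\<^sup>2 - (1 / w\<^sup>2 + T))"
        if "w \<noteq> 0" for w c
        using that by (simp add: field_simps power2_eq_square)
      moreover have "poly ([:-y, 1:] * q) z = (z - y) * poly q z"
        by (simp add: algebra_simps)
      ultimately show ?thesis using \<open>z - y \<noteq> 0\<close> by (simp only:)
    qed
    finally show ?case by (simp only: image_mset_add_mset prod_mset.add_mset sum_mset.add_mset q_def S_def T_def)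
  }
qed (simp_all add: pderiv_1)

lemma poly_pderiv_proots:
  assumes "poly p z \<noteq> (0::complex)"
  shows "poly (pderiv p) z = poly p z * (\<Sum>x\<in>#proots p. 1 / (z - x))"
    and "poly (pderiv (pderiv p)) z = poly p z *
           ((\<Sum>x\<in>#proots p. 1 / (z - x))\<^sup>2 - (\<Sum>x\<in>#proots p. 1 / (z - x)\<^sup>2))"
proof -
  define q where "q = (\<Prod>x\<in>#proots p. [:-x, 1:])"
  have z: "z \<notin># proots p" using assms by (cases "p = 0") auto
  have p: "p = smult (lead_coeff p) q"
    by (simp add: q_def complex_poly_decompose_multiset)
  show "poly (pderiv p) z = poly p z * (\<Sum>x\<in>#proots p. 1 / (z - x))"
    using poly_pderiv_linear_factors(1)[OF z, folded q_def]
    by (subst (1 2) p) (simp add: pderiv_smult)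
  show "poly (pderiv (pderiv p)) z = poly p z *
           ((\<Sum>x\<in>#proots p. 1 / (z - x))\<^sup>2 - (\<Sum>x\<in>#proots p. 1 / (z - x)\<^sup>2))"
    using poly_pderiv_linear_factors(2)[OF z, folded q_def]
    by (subst (1 2) p) (simp add: pderiv_smult)
qed

section \<open>Positivity of the roots and a quadratic relation\<close>

text \<open>The factor \<open>c\<close> will be \<open>Im z\<close>, which treats the upper and the
  lower half-plane at once.\<close>

lemma Im_sum_mset_nonpos:
  assumes "\<And>x. x \<in># M \<Longrightarrow> Im (f x) * c \<le> 0"
  shows "Im (\<Sum>x\<in>#M. f x) * c \<le> 0"
  using assms by (induction M) (auto simp: distrib_right add_nonpos_nonpos)

lemma Re_sum_mset_nonpos:
  assumes "\<And>x. x \<in># M \<Longrightarrow> Re (f x) \<le> 0"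
  shows "Re (\<Sum>x\<in>#M. f x) \<le> 0"
  using assms by (induction M) (auto simp: add_nonpos_nonpos)

text \<open>At a root \<open>z\<close> of the polynomial of degree \<open>m + 1\<close> that is not a root of its predecessor \<open>p\<close>, the
  contiguity relation reads \<open>B = A / z + (\<Sum>x. (1 + x) / (z - x))\<close>, summed over the roots of \<open>p\<close>. The right
  side is nonreal for nonreal \<open>z\<close> and nonpositive for \<open>z < 0\<close>.\<close>

lemma jac_roots_pos:
  assumes "real m \<le> A" "B > 0" "poly (jac m A B) z = 0"
  shows "Im z = 0 \<and> Re z > 0"
  using assms
proof (induction m arbitrary: A B z)
  case 0
  have "jac 0 A B = 1"
    using coeff_jac[of 0 0 A B] degree_jac[of 0 A B]
    by (metis degree_0_id diff_zero jac_coeff_def binomial_n_0 pochhammer_0 mult_1 div_by_1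
        le_refl of_nat_1 of_real_1 one_pCons)
  then show ?case using 0 by simp
next
  case (Suc m)
  \<comment> \<open>Lowering the degree lowers \<open>A\<close> by one and raises \<open>B\<close>
    by one, so both parameter conditions pass to \<open>p\<close>.\<close>
  define p where "p = jac m (A - 1) (B + 1)"
  have IH: "Im x = 0 \<and> Re x > 0" if "poly p x = 0" for x
    using Suc.IH[of "A - 1" "B + 1" x] Suc.prems that by (simp add: p_def)
  have "A > 0" using Suc.prems by simp
  \<comment> \<open>A root shared with \<open>p\<close> is covered by the induction hypothesis; at
    any other root one may divide by \<open>poly p z\<close>.\<close>
  show ?case
  proof (cases "poly p z = 0")
    case False
    define T where "T = (\<Sum>x\<in>#proots p. (1 + x) / (z - x))"
    have "p \<noteq> 0" by (simp add: p_def jac_nonzero)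
    have root: "Im x = 0 \<and> Re x > 0 \<and> z \<noteq> x" if "x \<in># proots p" for x
      using that IH[of x] False \<open>p \<noteq> 0\<close> by auto
    have step: "smult (of_real B) (jac (Suc m) A B) =
      [:- of_real A, of_real (B + m):] * p - [:0, 1, 1:] * pderiv p"
      using jac_step[of "B + 1" m "A - 1"] Suc.prems by (simp add: p_def)
    have "poly (smult (of_real B) (jac (Suc m) A B)) z =
      (- of_real A + z * (of_real B + of_nat m)) * poly p z - (z + z * z) * poly (pderiv p) z"
      unfolding step by (simp add: algebra_simps)
    then have "(- of_real A + z * (of_real B + of_nat m)) * poly p z
       = (z + z * z) * (poly p z * (\<Sum>x\<in>#proots p. 1 / (z - x)))"
      using Suc.prems(3) poly_pderiv_proots(1)[OF False] by simp
    moreover have "L = z * ((1 + z) * S)" if "L * c = (z + z * z) * (c * S)" "c \<noteq> 0" for L c S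
    proof -
      have "(z + z * z) * (c * S) = (z * ((1 + z) * S)) * c" by (simp add: algebra_simps)
      with that show ?thesis by simp
    qed
    ultimately have 1: "- of_real A + z * (of_real B + of_nat m) =
        z * ((1 + z) * (\<Sum>x\<in>#proots p. 1 / (z - x)))"
      using False by blast
    then have "z \<noteq> 0" using \<open>A > 0\<close> by auto
    \<comment> \<open>Each \<open>(1 + z) / (z - x)\<close> is \<open>1 + (1 + x) / (z - x)\<close>.
      The \<open>m\<close> ones cancel the \<open>m\<close> on the left and leave the positive
      residues \<open>1 + x\<close>.\<close>
    have "(1 + z) * (\<Sum>x\<in>#proots p. 1 / (z - x)) = (\<Sum>x\<in>#proots p. 1 + (1 + x) / (z - x))"
      unfolding sum_mset_distrib_left
      by (intro arg_cong[where f = sum_mset] image_mset_cong) (use root in \<open>auto simp: field_simps\<close>)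
    also have "\<dots> = of_nat m + T"
      using size_proots_complex[of p] by (simp add: sum_mset.distrib T_def p_def degree_jac)
    finally have "of_real B = of_real A / z + T"
      using 1 \<open>z \<noteq> 0\<close> by (simp add: field_simps)
    then have Im: "Im (of_real A / z) + Im T = 0" and Re: "Re (of_real A / z) + Re T = B"
      by (metis Im_complex_of_real plus_complex.simps(2), metis Re_complex_of_real plus_complex.simps(1))
    have nz: "(Re z)\<^sup>2 + (Im z)\<^sup>2 > 0" using \<open>z \<noteq> 0\<close> by (simp add: complex_neq_0)
    \<comment> \<open>Off the real axis \<open>A / z\<close> and all summands of \<open>T\<close>
      have imaginary parts of sign opposite to \<open>Im z\<close>, the first one strictly, so they
      cannot add up to the real number \<open>B\<close>.\<close>
    have "Im z = 0"
    proof (rule ccontr)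
      assume "Im z \<noteq> 0"
      have "Im (of_real A / z) * Im z = - (A * (Im z)\<^sup>2 / ((Re z)\<^sup>2 + (Im z)\<^sup>2))"
        by (simp add: Im_divide power2_eq_square)
      also have "\<dots> < 0" using \<open>A > 0\<close> nz \<open>Im z \<noteq> 0\<close> by (simp add: zero_less_divide_iff)
      finally have "Im (of_real A / z) * Im z < 0" .
      moreover have "Im T * Im z \<le> 0" unfolding T_def
      proof (rule Im_sum_mset_nonpos)
        fix x assume "x \<in># proots p"
        with root have "Im x = 0" "Re x > 0" by auto
        then have "Im ((1 + x) / (z - x)) * Im z = - ((1 + Re x) * (Im z)\<^sup>2) / ((Re z - Re x)\<^sup>2 + (Im z)\<^sup>2)"
          by (simp add: Im_divide power2_eq_square algebra_simps)
        then show "Im ((1 + x) / (z - x)) * Im z \<le> 0"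
          using \<open>Re x > 0\<close> by (simp add: divide_nonpos_nonneg)
      qed
      ultimately show False using Im by (metis add_neg_nonpos distrib_right less_irrefl mult_zero_left)
    qed
    \<comment> \<open>On the nonpositive axis every term on the right is nonpositive, while
      \<open>B > 0\<close>.\<close>
    moreover have "Re z > 0"
    proof (rule ccontr)
      assume neg: "\<not> Re z > 0"
      have "Re (of_real A / z) \<le> 0"
        using \<open>A > 0\<close> neg \<open>Im z = 0\<close> by (simp add: Re_divide divide_nonpos_nonneg mult_nonneg_nonpos)
      moreover have "Re T \<le> 0" unfolding T_def
      proof (rule Re_sum_mset_nonpos)
        fix x assume "x \<in># proots p"
        with root have "Im x = 0" "Re x > 0" by auto
        then show "Re ((1 + x) / (z - x)) \<le> 0"
          using \<open>Im z = 0\<close> neg by (simp add: Re_divide divide_nonpos_nonneg mult_nonneg_nonpos)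
      qed
      ultimately show False using Re \<open>B > 0\<close> by linarith
    qed
    ultimately show ?thesis by simp
  qed (use IH in simp)
qed

text \<open>For the polynomials of interest the roots are real and \<open>Re\<close> only changes
  the type; multiplicities are counted by \<open>proots\<close>.\<close>

definition root_mean :: "complex poly \<Rightarrow> (real \<Rightarrow> real) \<Rightarrow> real" where
  "root_mean p g = (\<Sum>z\<in>#proots p. g (Re z)) / real (degree p)"

text \<open>All roots are positive, so the differential equation may be divided by the polynomial at
  \<open>- x\<close>. There \<open>p'/p = - S\<close> and \<open>p''/p = S^2 - T\<close>;
  multiplying by \<open>x / m^2\<close> turns these sums into the means \<open>u = x S / m\<close>
  and \<open>v = x^2 T / m\<close>.\<close>

lemma jac_quadratic:
  fixes x :: real
  assumes "m \<ge> 1" "real m \<le> A" "B > 0" "x > 0"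
  defines "u \<equiv> root_mean (jac m A B) (\<lambda>t. x / (x + t))"
    and "v \<equiv> root_mean (jac m A B) (\<lambda>t. (x / (x + t))\<^sup>2)"
  shows "(x - 1) * (u\<^sup>2 - v / m) - (1 / m + A / m - 1 + (B / m + 2 - 2 / m) * x) * u
     + x * (B / m + 1 - 1 / m) = 0"
proof -
  define p where "p = jac m A B"
  define S T where "S = (\<Sum>z\<in>#proots p. 1 / (x + Re z))" and "T = (\<Sum>z\<in>#proots p. 1 / (x + Re z)\<^sup>2)"
  have "p \<noteq> 0" by (simp add: p_def jac_nonzero)
  have root: "z = of_real (Re z) \<and> Re z > 0" if "z \<in># proots p" for z
    using that jac_roots_pos[OF assms(2,3), of z] \<open>p \<noteq> 0\<close> by (auto simp: p_def complex_eq_iff)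
  have nz: "poly p (- of_real x) \<noteq> 0"
    using jac_roots_pos[OF assms(2,3), of "- of_real x"] \<open>x > 0\<close> by (auto simp: p_def)
  have of_real_sum_mset: "(\<Sum>x\<in>#M. of_real (f x)) = (of_real (\<Sum>x\<in>#M. f x) :: complex)"
    for f and M :: "complex multiset" by (induction M) auto
  have "(\<Sum>z\<in>#proots p. 1 / (- of_real x - z)) = (\<Sum>z\<in>#proots p. of_real (- 1 / (x + Re z)))"
  proof (intro arg_cong[where f = sum_mset] image_mset_cong)
    fix z assume "z \<in># proots p"
    with root obtain r where "z = of_real r" "r > 0" by blast
    moreover have "1 / (- x - r) = - 1 / (x + r)" using \<open>x > 0\<close> \<open>r > 0\<close> by (simp add: divide_simps)
    then have "1 / (- of_real x - of_real r) = (of_real (- 1 / (x + r)) :: complex)"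
      by (metis of_real_1 of_real_diff of_real_divide of_real_minus)
    ultimately show "1 / (- of_real x - z) = of_real (- 1 / (x + Re z))" by simp
  qed
  also have "\<dots> = of_real (\<Sum>z\<in>#proots p. (-1) * (1 / (x + Re z)))"
    unfolding of_real_sum_mset by simp
  also have "\<dots> = - of_real S" unfolding S_def sum_mset_distrib_left[symmetric] by simp
  finally have S: "(\<Sum>z\<in>#proots p. 1 / (- of_real x - z)) = - of_real S" .
  have "(\<Sum>z\<in>#proots p. 1 / (- of_real x - z)\<^sup>2) = (\<Sum>z\<in>#proots p. of_real (1 / (x + Re z)\<^sup>2))"
  proof (intro arg_cong[where f = sum_mset] image_mset_cong)
    fix z assume "z \<in># proots p"
    with root obtain r where "z = of_real r" "r > 0" by blast
    moreover have "(- of_real x - of_real r)\<^sup>2 = (of_real ((x + r)\<^sup>2) :: complex)"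
      by (simp add: power2_eq_square algebra_simps)
    ultimately show "1 / (- of_real x - z)\<^sup>2 = of_real (1 / (x + Re z)\<^sup>2)"
      by simp
  qed
  also have "\<dots> = of_real T" unfolding T_def of_real_sum_mset ..
  finally have T: "(\<Sum>z\<in>#proots p. 1 / (- of_real x - z)\<^sup>2) = of_real T" .
  \<comment> \<open>The left side of the differential equation at \<open>- x\<close>, divided by the
    value of \<open>p\<close> there.\<close>
  define d where "d = (- x + x * x) * (S\<^sup>2 - T) - (1 + A - m + (B + 2 * m - 2) * x) * S + m * (B + m - 1)"
  have "0 = poly ([:0, 1, 1:] * pderiv (pderiv p)
     + [:of_real (1 + A - real m), - of_real (B + 2 * real m - 2):] * pderiv p
     + smult (of_real (real m * (B + real m - 1))) p) (- of_real x)"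
    unfolding p_def jac_ode[OF assms(3)] by simp
  also have "\<dots> = poly p (- of_real x) * of_real d"
    unfolding poly_add poly_mult poly_smult poly_pderiv_proots[OF nz] S T d_def
    by (simp add: algebra_simps)
  finally have "d = 0" using nz by simp
  have u: "u * m = x * S"
    using \<open>m \<ge> 1\<close> by (simp add: u_def root_mean_def p_def[symmetric] S_def sum_mset_distrib_left) (simp add: p_def degree_jac)
  have v: "v * m = x\<^sup>2 * T"
    using \<open>m \<ge> 1\<close> by (simp add: v_def root_mean_def p_def[symmetric] T_def sum_mset_distrib_left power_divide) (simp add: p_def degree_jac)
  have "m\<^sup>2 * ((x - 1) * (u\<^sup>2 - v / m) - (1 / m + A / m - 1 + (B / m + 2 - 2 / m) * x) * u
     + x * (B / m + 1 - 1 / m)) = (x - 1) * ((u * m)\<^sup>2 - v * m) - (1 + A - m + (B + 2 * m - 2) * x) * (u * m)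
     + x * m * (B + m - 1)"
    using \<open>m \<ge> 1\<close> by (simp add: field_simps power2_eq_square)
  also have "\<dots> = x * d" unfolding u v d_def by (simp add: algebra_simps power2_eq_square)
  finally show ?thesis using \<open>d = 0\<close> \<open>m \<ge> 1\<close> by simp
qed

section \<open>Stieltjes transforms, tightness and uniqueness\<close>

text \<open>The index set \<open>S\<close> may exceed the support, so it stays fixed while the
  multiset grows in the induction.\<close>

lemma sum_mset_eq_sum_count:
  fixes f :: "'a \<Rightarrow> real"
  assumes "finite S" "set_mset M \<subseteq> S"
  shows "(\<Sum>x\<in>#M. f x) = (\<Sum>x\<in>S. real (count M x) * f x)"
  using assms(2)
proof (induction M)
  case (add y M)
  have "(\<Sum>x\<in>S. real (count (add_mset y M) x) * f x)
    = (\<Sum>x\<in>S. real (count M x) * f x + (if x = y then f x else 0))"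
    by (intro sum.cong) (auto simp: algebra_simps)
  also have "\<dots> = (\<Sum>x\<in>#M. f x) + f y"
    using add assms(1) by (simp add: sum.distrib)
  finally show ?case by simp
qed simp

lemma expectation_pmf_of_multiset:
  fixes f :: "'a \<Rightarrow> real"
  assumes "M \<noteq> {#}"
  shows "measure_pmf.expectation (pmf_of_multiset M) f = (\<Sum>x\<in>#M. f x) / real (size M)"
proof -
  have "measure_pmf.expectation (pmf_of_multiset M) f
      = (\<Sum>x\<in>set_mset M. f x * pmf (pmf_of_multiset M) x)"
    using assms by (intro integral_measure_pmf_real) auto
  also have "\<dots> = (\<Sum>x\<in>#M. f x) / real (size M)"
    using assms by (simp add: sum_mset_eq_sum_count[of "set_mset M"] sum_divide_distrib mult.commute)
  finally show ?thesis .
qed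

text \<open>Tightness of a single law, stated for all large \<open>K\<close> so that finitely many
  laws can share one bound.\<close>

lemma real_distribution_compact_mass:
  assumes "real_distribution M" "e > 0"
  shows "\<exists>K0. \<forall>K\<ge>K0. measure M {-K<..K} > 1 - e"
proof -
  interpret real_distribution M by fact
  have "(\<lambda>n. measure M {- real n<..real n}) \<longlonglongrightarrow> measure M (\<Union>n. {- real n<..real n})"
    by (intro finite_Lim_measure_incseq) (auto simp: incseq_def)
  also have "(\<Union>n. {- real n<..real n}) = UNIV"
  proof (intro set_eqI iffI UNIV_I)
    fix x :: real
    obtain n where "\<bar>x\<bar> < real n" using reals_Archimedean2 by blast
    then show "x \<in> (\<Union>n. {- real n<..real n})" by (intro UN_I[of n]) auto
  qed
  also have "measure M UNIV = 1" using prob_space by simp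
  finally have "\<forall>\<^sub>F n in sequentially. 1 - e < measure M {- real n<..real n}"
    using \<open>e > 0\<close> by (intro order_tendstoD(1)) auto
  then obtain n where n: "1 - e < measure M {- real n<..real n}"
    by (auto simp: eventually_sequentially)
  have "1 - e < measure M {-K<..K}" if "K \<ge> real n" for K
  proof -
    have "measure M {- real n<..real n} \<le> measure M {-K<..K}"
      using that by (intro finite_measure_mono) auto
    with n show ?thesis by simp
  qed
  then show ?thesis by blast
qed

text \<open>The tail of the sequence is controlled by assumption, and the finitely many remaining
  laws are tight one by one.\<close>

lemma tightI_eventually:
  assumes M: "\<And>n. real_distribution (M n)"
    and mass: "\<And>e. e > 0 \<Longrightarrow> \<exists>K. \<forall>\<^sub>F n in sequentially. measure (M n) {-K<..K} > 1 - e"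
  shows "tight M"
  unfolding tight_def
proof (intro conjI allI impI M)
  fix e :: real assume "e > 0"
  obtain K N where K: "\<And>n. n \<ge> N \<Longrightarrow> measure (M n) {-K<..K} > 1 - e"
    using mass[OF \<open>e > 0\<close>] by (auto simp: eventually_sequentially)
  have "\<exists>L. \<forall>L'\<ge>L. \<forall>n<k. measure (M n) {-L'<..L'} > 1 - e" for k
  proof (induction k)
    case (Suc k)
    then obtain L where "\<forall>L'\<ge>L. \<forall>n<k. measure (M n) {-L'<..L'} > 1 - e" by blast
    moreover obtain K0 where "\<forall>L'\<ge>K0. measure (M k) {-L'<..L'} > 1 - e"
      using real_distribution_compact_mass[OF M \<open>e > 0\<close>] by blast
    ultimately show ?case by (intro exI[of _ "max L K0"]) (auto simp: less_Suc_eq)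
  qed auto
  then obtain L where L: "\<forall>L'\<ge>L. \<forall>n<N. measure (M n) {-L'<..L'} > 1 - e" by blast
  \<comment> \<open>The \<open>1\<close> guarantees the nondegenerate interval that
    \<open>tight\<close> demands.\<close>
  define R where "R = max 1 (max K L)"
  have "measure (M n) {-R<..R} > 1 - e" for n
  proof (cases "n < N")
    case True then show ?thesis using L by (simp add: R_def)
  next
    case False
    interpret real_distribution "M n" by (rule M)
    have "measure (M n) {-K<..K} \<le> measure (M n) {-R<..R}"
      by (intro finite_measure_mono) (auto simp: R_def)
    with K[of n] False show ?thesis by simp
  qed
  moreover have "-R < R" by (simp add: R_def)
  ultimately show "\<exists>a b. a < b \<and> (\<forall>n. 1 - e < measure (M n) {a<..b})" by blast
qed

text \<open>The substitution \<open>s = 1/(1+t)\<close> compactifies the half-line; the truncation makes it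
  continuous on the whole line.\<close>

definition compactify :: "real \<Rightarrow> real" where
  "compactify t = 1 / (1 + max 0 t)"

lemma compactify_bounds: "0 < compactify t" "compactify t \<le> 1"
  by (auto simp: compactify_def)

lemma compactify_mem: "compactify t \<in> {0..1}"
  using compactify_bounds[of t] by simp

lemma continuous_compactify: "continuous_on UNIV compactify"
  unfolding compactify_def by (intro continuous_intros) (auto simp: max_def)

lemma measurable_compactify [measurable]: "compactify \<in> borel_measurable borel"
  by (rule borel_measurable_continuous_onI[OF continuous_compactify])

lemma (in real_distribution) integrable_compactify:
  fixes f :: "real \<Rightarrow> real"
  assumes "continuous_on {0..1} f"
  shows "integrable M (\<lambda>t. f (compactify t))"
proof -
  have "continuous_on UNIV (\<lambda>t. f (compactify t))"
    using compactify_mem by (intro continuous_on_compose2[OF assms continuous_compactify]) auto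
  then have [measurable]: "(\<lambda>t. f (compactify t)) \<in> borel_measurable borel"
    by (rule borel_measurable_continuous_onI)
  have "bounded (f ` {0..1})"
    by (intro compact_imp_bounded compact_continuous_image assms compact_Icc)
  then obtain C where "\<forall>x\<in>{0..1}. norm (f x) \<le> C" by (auto simp: bounded_iff)
  then show ?thesis
    using compactify_mem by (intro integrable_const_bound[of _ C]) (auto simp del: atLeastAtMost_iff)
qed

section \<open>Resolvent kernels on the unit interval and recovery of the measure\<close>

lemma continuous_resolvent_kernel:
  fixes h :: real
  assumes "0 < h" "h \<le> 1/2"
  shows "continuous_on {0..1} (\<lambda>s. s ^ k / (1 - h * s))"
proof (intro continuous_intros ballI)
  fix s :: real assume "s \<in> {0..1}"
  then have "h * s \<le> (1/2) * 1" using assms by (intro mult_mono) auto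
  then show "1 - h * s \<noteq> 0" by simp
qed

text \<open>The difference is \<open>s^k * h s / (1 - h s)\<close>, whose denominator is at least
  \<open>1/2\<close>; hence the kernels tend to the power uniformly as \<open>h\<close> tends to
  \<open>0\<close>.\<close>

lemma resolvent_kernel_bound:
  fixes h s :: real
  assumes "0 < h" "h \<le> 1/2" "0 \<le> s" "s \<le> 1"
  shows "\<bar>s ^ k / (1 - h * s) - s ^ k\<bar> \<le> 2 * h"
proof -
  have hs: "h * s \<le> h" "h * s \<ge> 0" using assms by (simp_all add: mult_left_le)
  then have "h * s \<le> 1 / 2" using assms by linarith
  have "s ^ k / (1 - h * s) - s ^ k = s ^ k * (h * s) / (1 - h * s)"
    using \<open>h * s \<le> 1 / 2\<close> by (simp add: field_simps)
  moreover have "0 \<le> s ^ k * (h * s) / (1 - h * s)" using hs \<open>h * s \<le> 1 / 2\<close> assms by simp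
  moreover have "s ^ k * (h * s) / (1 - h * s) \<le> (1 * h) / (1/2)"
    using hs \<open>h * s \<le> 1 / 2\<close> assms by (intro frac_le mult_mono power_le_one) auto
  ultimately show ?thesis by (simp only: abs_of_nonneg) simp
qed

text \<open>With \<open>s = 1/(1+t)\<close>, letting \<open>h \<rightarrow> 0\<close> in the integral of \<open>s^k / (1 - h s)\<close> gives the \<open>k\<close>-th moment, and
  \<open>s^(k+1) / (1 - h s) = (s^k / (1 - h s) - s^k) / h\<close>, so the Stieltjes transform determines all moments
  of the compactified measure.\<close>

lemma stieltjes_determines_measure:
  assumes "real_distribution M" "real_distribution N"
    and M0: "AE t in M. 0 \<le> t" and N0: "AE t in N. 0 \<le> t"
    and eq: "\<And>x. x > 0 \<Longrightarrow> (LINT t|M. x / (x + t)) = (LINT t|N. x / (x + t))"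
  shows "M = N"
proof -
  interpret M: real_distribution M by fact
  interpret N: real_distribution N by fact
  define D where "D f \<longleftrightarrow> (LINT t|M. f (compactify t)) = (LINT t|N. f (compactify t))"
    for f :: "real \<Rightarrow> real"
  \<comment> \<open>The set of continuous functions on which both measures agree is closed under
    uniform limits.\<close>
  have approx: "D f"
    if f: "continuous_on {0..1} f"
      and g: "\<And>e. e > 0 \<Longrightarrow> \<exists>g. continuous_on {0..1} g \<and> D g \<and> (\<forall>s\<in>{0..1}. \<bar>f s - g s\<bar> \<le> e)" for f
  proof -
    have "\<bar>(LINT t|M. f (compactify t)) - (LINT t|N. f (compactify t))\<bar> \<le> 0 + e" if "e > 0" for e
    proof -
      obtain g where g: "continuous_on {0..1} g" "D g" "\<forall>s\<in>{0..1}. \<bar>f s - g s\<bar> \<le> e / 2"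
        using g[of "e / 2"] \<open>e > 0\<close> by auto
      have bound: "\<bar>(LINT t|L. f (compactify t)) - (LINT t|L. g (compactify t))\<bar> \<le> e / 2"
        if "real_distribution L" for L
      proof -
        interpret L: real_distribution L by fact
        have "(LINT t|L. f (compactify t)) - (LINT t|L. g (compactify t))
            = (LINT t|L. f (compactify t) - g (compactify t))"
          using f g by (intro Bochner_Integration.integral_diff[symmetric] L.integrable_compactify)
        also have "\<bar>\<dots>\<bar> \<le> (LINT t|L. \<bar>f (compactify t) - g (compactify t)\<bar>)"
          by (rule integral_abs_bound)
        also have "\<dots> \<le> (LINT t|L. e / 2)"
          using f g(1) bspec[OF g(3) compactify_mem]
          by (intro integral_mono integrable_abs Bochner_Integration.integrable_diff
              L.integrable_compactify) auto
        finally show ?thesis using L.prob_space by simp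
      qed
      show ?thesis using bound[OF assms(1)] bound[OF assms(2)] g(2) unfolding D_def by linarith
    qed
    then have "\<bar>(LINT t|M. f (compactify t)) - (LINT t|N. f (compactify t))\<bar> \<le> 0"
      by (rule field_le_epsilon)
    then show ?thesis by (simp add: D_def)
  qed
  have moment: "D (\<lambda>s. s ^ k)" if "\<And>h. 0 < h \<Longrightarrow> h \<le> 1/2 \<Longrightarrow> D (\<lambda>s. s ^ k / (1 - h * s))" for k
  proof (rule approx)
    fix e :: real assume "e > 0"
    define h where "h = min (1/2) (e / 2)"
    have h: "0 < h" "h \<le> 1/2" "2 * h \<le> e" using \<open>e > 0\<close> by (auto simp: h_def)
    then show "\<exists>g. continuous_on {0..1} g \<and> D g \<and> (\<forall>s\<in>{0..1}. \<bar>s ^ k - g s\<bar> \<le> e)"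
      using that[OF h(1,2)] continuous_resolvent_kernel[OF h(1,2), of k] resolvent_kernel_bound[OF h(1,2), of _ k]
      by (intro exI[of _ "\<lambda>s. s ^ k / (1 - h * s)"]) (force simp: abs_minus_commute)
  qed (intro continuous_intros)
  \<comment> \<open>The bound variable \<open>h\<close> is generalised: the next kernel also needs a
    power moment, which is a limit over all small \<open>h\<close>.\<close>
  have kernel: "D (\<lambda>s. s ^ Suc k / (1 - h * s))" if "0 < h" "h \<le> 1/2" for h k
    using that
  proof (induction k arbitrary: h)
    case 0
    \<comment> \<open>With \<open>s = 1/(1+t)\<close> the kernel \<open>s / (1 - h s)\<close> equals
      \<open>1 / (1 - h + t)\<close>, a multiple of the Stieltjes integrand at
      \<open>1 - h\<close>.\<close>
    have *: "compactify t / (1 - h * compactify t) = ((1 - h) / (1 - h + t)) / (1 - h)" if "0 \<le> t" for t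
      using that 0 by (simp add: compactify_def divide_simps)
    have "(LINT t|L. compactify t / (1 - h * compactify t)) = (LINT t|L. (1 - h) / (1 - h + t)) / (1 - h)"
      if "AE t in L. 0 \<le> t" "sets L = sets borel" for L
    proof -
      have [measurable_cong]: "sets L = sets borel" by fact
      have "(LINT t|L. compactify t / (1 - h * compactify t)) = (LINT t|L. ((1 - h) / (1 - h + t)) / (1 - h))"
      proof (rule integral_cong_AE)
        show "AE t in L. compactify t / (1 - h * compactify t) = ((1 - h) / (1 - h + t)) / (1 - h)"
          using that(1) by (rule eventually_mono) (rule *)
      qed measurable
      then show ?thesis by (simp only: integral_divide_zero)
    qed
    then show ?case using M0 N0 eq[of "1 - h"] 0 by (simp add: D_def)
  next
    case (Suc k)
    have c1: "continuous_on {0..1} (\<lambda>s. s ^ Suc k / (1 - h * s))"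
      using Suc.prems by (rule continuous_resolvent_kernel)
    have c2: "continuous_on {0..1} (\<lambda>s::real. s ^ Suc k)" by (intro continuous_intros)
    have *: "s ^ Suc (Suc k) / (1 - h * s) = (s ^ Suc k / (1 - h * s) - s ^ Suc k) / h" if "0 < s" "s \<le> 1" for s
    proof -
      have "h * s \<le> (1/2) * 1" using Suc.prems that by (intro mult_mono) auto
      then show ?thesis using Suc.prems by (simp add: field_simps)
    qed
    have "(LINT t|L. compactify t ^ Suc (Suc k) / (1 - h * compactify t))
       = ((LINT t|L. compactify t ^ Suc k / (1 - h * compactify t)) - (LINT t|L. compactify t ^ Suc k)) / h"
      if "real_distribution L" for L
    proof -
      interpret L: real_distribution L by fact
      show ?thesis
        unfolding *[OF compactify_bounds]
        using L.integrable_compactify[OF c1] L.integrable_compactify[OF c2] by simp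
    qed
    then show ?case
      using assms(1,2) Suc.IH[OF Suc.prems] moment[OF Suc.IH] unfolding D_def by simp
  qed
  have powers: "D (\<lambda>s. s ^ k)" for k
  proof (cases k)
    case 0 then show ?thesis using M.prob_space N.prob_space by (simp add: D_def)
  next
    case (Suc j) then show ?thesis using moment kernel by blast
  qed
  \<comment> \<open>Moments give all polynomials, and Weierstrass approximation gives all continuous
    functions.\<close>
  have D_cont: "D f" if f: "continuous_on {0..1} f" for f
  proof (rule approx[OF f])
    fix e :: real assume "e > 0"
    obtain g where g: "real_polynomial_function g" "\<And>s. s \<in> {0..1} \<Longrightarrow> \<bar>f s - g s\<bar> < e"
      using Stone_Weierstrass_real_polynomial_function[OF compact_Icc f \<open>e > 0\<close>] by blast
    obtain c n where c: "g = (\<lambda>s. \<Sum>i\<le>n. c i * s ^ i)"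
      using g(1) by (auto simp: real_polynomial_function_iff_sum)
    have "D g"
      using powers unfolding D_def c
      by (subst (1 2) Bochner_Integration.integral_sum)
        (auto intro!: M.integrable_compactify N.integrable_compactify continuous_intros)
    moreover have "continuous_on {0..1} g" unfolding c by (intro continuous_intros)
    ultimately show "\<exists>g. continuous_on {0..1} g \<and> D g \<and> (\<forall>s\<in>{0..1}. \<bar>f s - g s\<bar> \<le> e)"
      using g(2) by (auto intro!: exI[of _ g] less_imp_le)
  qed
  \<comment> \<open>Cosine and sine are among these functions, so the compactified laws have equal
    characteristic functions.\<close>
  have "char (distr M borel compactify) = char (distr N borel compactify)"
  proof
    fix \<theta> :: real
    have "D (\<lambda>s. cos (\<theta> * s))" "D (\<lambda>s. sin (\<theta> * s))"
      by (intro D_cont continuous_intros)+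
    moreover have "char (distr L borel compactify) \<theta> =
      Complex (LINT t|L. cos (\<theta> * compactify t)) (LINT t|L. sin (\<theta> * compactify t))"
      if "real_distribution L" for L
    proof -
      interpret L: real_distribution L by fact
      have i: "integrable L (\<lambda>t. iexp (\<theta> * compactify t))"
        by (intro L.integrable_iexp) auto
      have "char (distr L borel compactify) \<theta> = (CLINT t|L. iexp (\<theta> * compactify t))"
        unfolding char_def by (subst integral_distr) auto
      then show ?thesis
        using integral_Re[OF i] integral_Im[OF i] by (simp add: complex_eq_iff Re_exp Im_exp)
    qed
    ultimately show "char (distr M borel compactify) \<theta> = char (distr N borel compactify) \<theta>"
      using assms(1,2) by (simp add: D_def)
  qed
  then have eq: "distr M borel compactify = distr N borel compactify"
    by (intro Levy_uniqueness) auto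
  \<comment> \<open>On the nonnegative half-line \<open>1 / s - 1\<close> inverts
    \<open>compactify\<close>, so the original law is recovered from its image.\<close>
  have inv: "L = distr (distr L borel compactify) borel (\<lambda>s. 1 / s - 1)"
    if "real_distribution L" "AE t in L. 0 \<le> t" for L
  proof -
    interpret L: real_distribution L by fact
    have "distr (distr L borel compactify) borel (\<lambda>s. 1 / s - 1)
       = distr L borel (\<lambda>t. 1 / compactify t - 1)"
      by (subst distr_distr) (auto simp: comp_def)
    also have "\<dots> = distr L L (\<lambda>t. t)"
      using that(2) by (intro distr_cong_AE) (auto simp: compactify_def)
    finally show ?thesis by simp
  qed
  show "M = N"
    using inv[OF assms(1) M0] inv[OF assms(2) N0] eq by simp
qed

section \<open>The S-transform of the free beta prime distribution\<close>

definition is_beta_root :: "real \<Rightarrow> real \<Rightarrow> real \<Rightarrow> real \<Rightarrow> bool" where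
  "is_beta_root a b x u \<longleftrightarrow> 0 < u \<and> u < 1 \<and> x * (1 - u) * (b - u) = u * (a - 1 + u)"

definition beta_root :: "real \<Rightarrow> real \<Rightarrow> real \<Rightarrow> real" where
  "beta_root a b x = (THE u. is_beta_root a b x u)"

text \<open>Subtracting the equation for \<open>u\<close> lets \<open>w - u\<close> factor out, and
  the cofactor is at least \<open>u\<close>. An approximate solution is therefore close to the exact
  one; with defect zero this is uniqueness.\<close>

lemma beta_root_stable:
  assumes "a \<ge> 1" "b \<ge> 1" "x > 0" "is_beta_root a b x u" "0 \<le> w" "w \<le> 1"
  shows "\<bar>w - u\<bar> * u \<le> \<bar>x * (1 - w) * (b - w) - w * (a - 1 + w)\<bar>"
proof -
  have u: "0 < u" "u < 1" "x * (1 - u) * (b - u) = u * (a - 1 + u)"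
    using assms(4) by (auto simp: is_beta_root_def)
  have "x * (1 - w) * (b - w) - w * (a - 1 + w)
      = - ((w - u) * (x * (1 + b - w - u) + (w + u + (a - 1))))"
    using u(3) by (simp add: algebra_simps)
  moreover have "u \<le> x * (1 + b - w - u) + (w + u + (a - 1))"
    using assms u mult_nonneg_nonneg[of x "1 + b - w - u"] by linarith
  ultimately show ?thesis using u(1) by (simp add: abs_mult mult_left_mono)
qed

lemma beta_root_unique:
  assumes "a \<ge> 1" "b \<ge> 1" "x > 0" "is_beta_root a b x u" "is_beta_root a b x w"
  shows "w = u"
  using beta_root_stable[OF assms(1-4), of w] assms(4,5)
  by (auto simp: is_beta_root_def mult_le_0_iff)

lemma is_beta_root_beta_root:
  assumes "a \<ge> 1" "b \<ge> 1" "x > 0"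
  shows "is_beta_root a b x (beta_root a b x)"
proof -
  define g where "g u = u * (a - 1 + u) - x * (1 - u) * (b - u)" for u
  \<comment> \<open>Sign change: \<open>g 0 = - x * b\<close> is negative and \<open>g 1 = a\<close>
    is positive, which also excludes both endpoints.\<close>
  have "\<exists>u\<ge>0. u \<le> 1 \<and> g u = 0"
    using assms by (intro IVT') (auto simp: g_def intro!: continuous_intros)
  then obtain u where u: "0 \<le> u" "u \<le> 1" "g u = 0" by blast
  moreover have "u \<noteq> 0" "u \<noteq> 1" using u assms by (auto simp: g_def)
  ultimately have "is_beta_root a b x u" by (auto simp: is_beta_root_def g_def)
  then show ?thesis
    unfolding beta_root_def using beta_root_unique[OF assms \<open>is_beta_root a b x u\<close>] by (rule theI)
qed

lemma beta_root_eqI: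
  "a \<ge> 1 \<Longrightarrow> b \<ge> 1 \<Longrightarrow> x > 0 \<Longrightarrow> is_beta_root a b x u \<Longrightarrow> beta_root a b x = u"
  using beta_root_unique is_beta_root_beta_root by blast

text \<open>The first bound, for small \<open>x\<close>, will exclude an atom at \<open>0\<close>;
  the second, for large \<open>x\<close>, will give tightness.\<close>

lemma beta_root_small:
  assumes "a \<ge> 1" "b \<ge> 1" "x > 0"
  shows "(beta_root a b x)\<^sup>2 \<le> b * x" "(1 - beta_root a b x)\<^sup>2 \<le> a / x"
proof -
  define u where "u = beta_root a b x"
  have u: "0 < u" "u < 1" "x * (1 - u) * (b - u) = u * (a - 1 + u)"
    using is_beta_root_beta_root[OF assms] by (auto simp: is_beta_root_def u_def)
  have "u\<^sup>2 \<le> u * (a - 1 + u)"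
    using u assms by (simp add: power2_eq_square algebra_simps)
  also have "\<dots> = x * ((1 - u) * (b - u))" using u by simp
  also have "\<dots> \<le> x * (1 * b)"
    using u assms by (intro mult_left_mono mult_mono) auto
  finally show "(beta_root a b x)\<^sup>2 \<le> b * x" by (simp add: u_def mult.commute)
  have "x * (1 - u)\<^sup>2 \<le> x * ((1 - u) * (b - u))"
    unfolding power2_eq_square using u assms by (intro mult_left_mono) auto
  also have "\<dots> = u * (a - 1 + u)" using u by simp
  also have "\<dots> \<le> 1 * a" using u assms by (intro mult_mono) auto
  finally show "(1 - beta_root a b x)\<^sup>2 \<le> a / x"
    using assms by (simp add: u_def field_simps)
qed

text \<open>The integral of \<open>1 / (x + t)\<close> scaled by \<open>x\<close>, which puts the
  values in \<open>[0, 1]\<close> for probability measures on the nonnegative reals.\<close>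

definition stieltjes :: "real measure \<Rightarrow> real \<Rightarrow> real" where
  "stieltjes \<mu> x = (LINT t|\<mu>. x / (x + t))"

lemma (in real_distribution) integrable_stieltjes:
  assumes "AE t in M. 0 \<le> t" "x > 0"
  shows "integrable M (\<lambda>t. x / (x + t))"
proof (rule integrable_const_bound[of _ 1])
  show "AE t in M. norm (x / (x + t)) \<le> 1"
    using assms(1) by (rule eventually_mono) (use assms(2) in auto)
qed measurable

lemma (in real_distribution) Psi_transform_eq:
  assumes "AE t in M. 0 \<le> t" "x > 0"
  shows "Psi_transform M (- 1 / x) = stieltjes M x - 1"
proof -
  have "Psi_transform M (- 1 / x) = (LINT t|M. x / (x + t) - 1)"
    unfolding Psi_transform_def
  proof (rule integral_cong_AE)
    show "AE t in M. t * (- 1 / x) / (1 - t * (- 1 / x)) = x / (x + t) - 1"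
      using assms(1)
    proof (rule eventually_mono)
      fix t :: real assume "0 \<le> t"
      then have "x + t > 0" "1 + t / x > 0" using assms(2) by (auto intro: add_pos_nonneg)
      then show "t * (- 1 / x) / (1 - t * (- 1 / x)) = x / (x + t) - 1"
        using assms(2) by (simp add: divide_simps)
    qed
  qed measurable
  then show ?thesis
    using integrable_stieltjes[OF assms] prob_space by (simp add: stieltjes_def)
qed

lemma (in real_distribution) stieltjes_bounds:
  assumes "AE t in M. 0 < t" "x > 0"
  shows "0 < stieltjes M x" "stieltjes M x < 1"
proof -
  have nn: "AE t in M. 0 \<le> t" using assms(1) by (rule eventually_mono) simp
  have ne: "emeasure M (space M) \<noteq> 0" using emeasure_space_1 by simp
  have "(LINT t|M. 0) < stieltjes M x" unfolding stieltjes_def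
    by (rule integral_less_AE_space[OF _ integrable_stieltjes[OF nn assms(2)] _ ne])
       (use assms in \<open>auto elim!: eventually_mono\<close>)
  then show "0 < stieltjes M x" by simp
  have "stieltjes M x < (LINT t|M. 1)" unfolding stieltjes_def
    by (rule integral_less_AE_space[OF integrable_stieltjes[OF nn assms(2)] _ _ ne])
       (use assms in \<open>auto elim!: eventually_mono\<close>)
  then show "stieltjes M x < 1" using prob_space by simp
qed

text \<open>For \<open>t > 0\<close> the integrand \<open>x / (x + t)\<close> is strictly increasing
  in \<open>x\<close>, and \<open>s = - 1 / x\<close> parametrises the negative half-line.\<close>

lemma (in real_distribution) inj_on_Psi_transform:
  assumes "AE t in M. 0 < t"
  shows "inj_on (Psi_transform M) {..<0}"
proof -
  have nn: "AE t in M. 0 \<le> t" using assms(1) by (rule eventually_mono) simp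
  have ne: "emeasure M (space M) \<noteq> 0" using emeasure_space_1 by simp
  have less: "stieltjes M x < stieltjes M y" if "0 < x" "x < y" for x y
    unfolding stieltjes_def
  proof (rule integral_less_AE_space[OF integrable_stieltjes[OF nn] integrable_stieltjes[OF nn] _ ne])
    show "AE t in M. x / (x + t) < y / (y + t)"
      using assms
    proof (rule eventually_mono)
      fix t :: real assume "0 < t"
      then have "x * t < y * t" using that by simp
      then show "x / (x + t) < y / (y + t)" using that \<open>0 < t\<close> by (simp add: divide_simps algebra_simps)
    qed
  qed (use that in auto)
  have P: "Psi_transform M s = stieltjes M (- 1 / s) - 1" "0 < - 1 / s" if "s < 0" for s
    using Psi_transform_eq[OF nn, of "- 1 / s"] that by (auto simp: field_simps)
  show ?thesis
  proof (rule inj_onI)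
    fix r s assume rs: "r \<in> {..<0}" "s \<in> {..<0}" "Psi_transform M r = Psi_transform M s"
    then have "stieltjes M (- 1 / r) = stieltjes M (- 1 / s)" using P(1) by simp
    then have "- 1 / r = - 1 / s"
      using less[of "- 1 / r" "- 1 / s"] less[of "- 1 / s" "- 1 / r"] P(2) rs by (cases "- 1 / r" "- 1 / s" rule: linorder_cases) auto
    then show "r = s" by simp
  qed
qed

lemma (in real_distribution) AE_pos_iff:
  assumes "AE t in M. 0 \<le> t"
  shows "(AE t in M. 0 < t) \<longleftrightarrow> measure M {0} = 0"
proof -
  have "measure M {0} = 0 \<longleftrightarrow> (AE t in M. t \<notin> {0})"
    by (subst AE_iff_measurable[of "{0}"]) (auto simp: emeasure_eq_measure)
  also have "\<dots> \<longleftrightarrow> (AE t in M. 0 < t)"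
    using assms by (auto elim!: AE_mp)
  finally show ?thesis by simp
qed

text \<open>As \<open>a\<close> is at least \<open>1\<close>, the domain condition says that there
  is no atom at \<open>0\<close>. Then the Psi transform is injective on the negative half-line, and
  its inverse can be evaluated at \<open>u - 1\<close>, where the prescribed S-transform becomes the
  quadratic equation for \<open>u\<close>.\<close>

lemma is_free_beta_prime_iff:
  assumes "a \<ge> 1" "b \<ge> 1"
  shows "is_free_beta_prime a b \<mu> \<longleftrightarrow>
    real_distribution \<mu> \<and> (AE t in \<mu>. 0 \<le> t) \<and> (\<forall>x>0. stieltjes \<mu> x = beta_root a b x)"
    (is "?L \<longleftrightarrow> ?R")
proof
  assume L: ?L
  then interpret real_distribution \<mu>
    by (auto simp: is_free_beta_prime_def real_distribution_def real_distribution_axioms_def)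
  have nn: "AE t in \<mu>. 0 \<le> t" and "measure \<mu> {0} = 0"
    using L assms by (auto simp: is_free_beta_prime_def min_def split: if_splits)
  then have pos: "AE t in \<mu>. 0 < t" using AE_pos_iff by blast
  have "stieltjes \<mu> x = beta_root a b x" if "x > 0" for x
  proof -
    define u where "u = stieltjes \<mu> x"
    have u: "0 < u" "u < 1" using stieltjes_bounds[OF pos that] by (simp_all add: u_def)
    have Psi: "Psi_transform \<mu> (- 1 / x) = u - 1"
      using Psi_transform_eq[OF nn that] by (simp add: u_def)
    have "the_inv_into {..<0} (Psi_transform \<mu>) (u - 1) = - 1 / x"
      unfolding Psi[symmetric] using that by (intro the_inv_into_f_f inj_on_Psi_transform pos) auto
    moreover have "S_transform \<mu> (u - 1) = (b - 1 - (u - 1)) / (a + (u - 1))"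
      using L u assms by (auto simp: is_free_beta_prime_def min_def split: if_splits)
    ultimately have "u / (u - 1) * (- 1 / x) = (b - u) / (a - 1 + u)"
      by (simp add: S_transform_def algebra_simps)
    moreover have "a - 1 + u > 0" using u assms by simp
    ultimately have "is_beta_root a b x u"
      using u that by (simp add: is_beta_root_def divide_simps) (simp add: algebra_simps)
    then show ?thesis using beta_root_eqI[OF assms that] by (simp add: u_def)
  qed
  then show ?R using nn real_distribution_axioms by blast
next
  assume R: ?R
  then interpret real_distribution \<mu> by simp
  have nn: "AE t in \<mu>. 0 \<le> t" using R by simp
  have S: "stieltjes \<mu> x = beta_root a b x" if "x > 0" for x using R that by simp
  have "measure \<mu> {0} = 0"
  proof (rule ccontr)
    assume "measure \<mu> {0} \<noteq> 0"
    then have d: "measure \<mu> {0} > 0" by (simp add: zero_less_measure_iff)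
    define d where "d = measure \<mu> {0}"
    \<comment> \<open>Chosen so that \<open>b * x\<close> is half of \<open>d^2\<close>, while an
      atom of mass \<open>d\<close> would force the transform to be at least
      \<open>d\<close>.\<close>
    define x where "x = d\<^sup>2 / (2 * b)"
    have "x > 0" using d assms by (simp add: x_def d_def)
    have "d = (LINT t|\<mu>. indicator {0} t)" by (simp add: d_def)
    also have "\<dots> \<le> stieltjes \<mu> x" unfolding stieltjes_def
    proof (rule integral_mono_AE)
      show "AE t in \<mu>. indicator {0} t \<le> x / (x + t)"
        using nn by (rule eventually_mono) (use \<open>x > 0\<close> in \<open>auto simp: indicator_def\<close>)
    qed (use integrable_stieltjes[OF nn \<open>x > 0\<close>] in \<open>auto simp: emeasure_eq_measure intro!: integrable_real_indicator\<close>)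
    finally have "d\<^sup>2 \<le> (beta_root a b x)\<^sup>2"
      using S[OF \<open>x > 0\<close>] d by (intro power_mono) (auto simp: d_def)
    also have "\<dots> \<le> b * x" using beta_root_small(1)[OF assms \<open>x > 0\<close>] .
    also have "\<dots> = d\<^sup>2 / 2" using assms by (simp add: x_def)
    finally show False using d by (simp add: d_def)
  qed
  then have pos: "AE t in \<mu>. 0 < t" using AE_pos_iff[OF nn] by blast
  have "\<mu> \<noteq> return borel 0"
    using \<open>measure \<mu> {0} = 0\<close> by (auto simp: measure_return)
  moreover have "S_transform \<mu> z = (b - 1 - z) / (a + z)" if "-1 < z" "z < 0" for z
  proof -
    define u where "u = 1 + z"
    \<comment> \<open>The quadratic equation is linear in \<open>x\<close>; this is its solution for
      the given \<open>u\<close>.\<close>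
    define x where "x = u * (a - 1 + u) / ((1 - u) * (b - u))"
    have u: "0 < u" "u < 1" "0 < a - 1 + u" "0 < b - u" using that assms by (auto simp: u_def)
    then have "x > 0" by (simp add: x_def)
    have "is_beta_root a b x u" using u by (simp add: is_beta_root_def x_def)
    then have "stieltjes \<mu> x = u" using beta_root_eqI[OF assms \<open>x > 0\<close>] S[OF \<open>x > 0\<close>] by simp
    then have Psi: "Psi_transform \<mu> (- 1 / x) = z"
      using Psi_transform_eq[OF nn \<open>x > 0\<close>] by (simp add: u_def)
    have "the_inv_into {..<0} (Psi_transform \<mu>) z = - 1 / x"
      unfolding Psi[symmetric] using \<open>x > 0\<close> by (intro the_inv_into_f_f inj_on_Psi_transform pos) auto
    then have "S_transform \<mu> z = u / (1 - u) / x"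
      by (simp add: S_transform_def u_def divide_simps)
    also have "\<dots> = (b - u) / (a - 1 + u)"
      using u by (simp add: x_def)
    finally show ?thesis by (simp add: u_def algebra_simps)
  qed
  ultimately show ?L
    using nn \<open>measure \<mu> {0} = 0\<close> assms prob_space_axioms
    by (auto simp: is_free_beta_prime_def min_def)
qed

text \<open>One measure with the right transform settles existence, and the transform determines the
  measure, so the definite description denotes it.\<close>

lemma free_beta_prime_eqI:
  assumes "a \<ge> 1" "b \<ge> 1" "real_distribution \<mu>" "AE t in \<mu>. 0 \<le> t"
    and "\<And>x. x > 0 \<Longrightarrow> stieltjes \<mu> x = beta_root a b x"
  shows "free_beta_prime a b = \<mu>"
  unfolding free_beta_prime_def
proof (rule the_equality)
  show "is_free_beta_prime a b \<mu>" using assms by (simp add: is_free_beta_prime_iff)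
  fix \<nu> assume "is_free_beta_prime a b \<nu>"
  then have "real_distribution \<nu>" "AE t in \<nu>. 0 \<le> t" "\<forall>x>0. stieltjes \<nu> x = beta_root a b x"
    using assms by (simp_all add: is_free_beta_prime_iff)
  then show "\<nu> = \<mu>"
    using assms by (intro stieltjes_determines_measure) (auto simp: stieltjes_def)
qed

section \<open>Convergence\<close>

lemma root_mean_bounds:
  assumes "\<And>z. z \<in># proots p \<Longrightarrow> 0 \<le> g (Re z) \<and> g (Re z) \<le> 1" "degree p > 0"
  shows "0 \<le> root_mean p g" "root_mean p g \<le> 1"
proof -
  have *: "0 \<le> (\<Sum>z\<in>#M. g (Re z)) \<and> (\<Sum>z\<in>#M. g (Re z)) \<le> real (size M)"
    if "\<And>z. z \<in># M \<Longrightarrow> 0 \<le> g (Re z) \<and> g (Re z) \<le> 1" for M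
    using that
  proof (induction M)
    case (add y M)
    have "0 \<le> g (Re y) \<and> g (Re y) \<le> 1" using add.prems by simp
    moreover have "0 \<le> (\<Sum>z\<in>#M. g (Re z)) \<and> (\<Sum>z\<in>#M. g (Re z)) \<le> real (size M)"
      using add by simp
    ultimately show ?case by simp
  qed simp
  show "0 \<le> root_mean p g" "root_mean p g \<le> 1"
    using *[of "proots p", OF assms(1)] assms(2) by (simp_all add: root_mean_def size_proots_complex)
qed

lemma proots_jac:
  assumes "real m \<le> A" "B > 0" "z \<in># proots (jac m A B)"
  shows "z = of_real (Re z)" "Re z > 0"
  using jac_roots_pos[OF assms(1,2), of z] assms(3) jac_nonzero[of m A B]
  by (auto simp: complex_eq_iff)

text \<open>The relation \<open>jac_quadratic\<close> is the limiting quadratic equation with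
  perturbed coefficients. Since \<open>u\<close> and \<open>v\<close> lie in \<open>[0, 1]\<close>,
  the defect of \<open>u\<close> tends to \<open>0\<close>, and stability of the root transfers this
  to \<open>u\<close> itself.\<close>

lemma root_mean_jac_tendsto:
  fixes m :: "nat \<Rightarrow> nat" and A B :: "nat \<Rightarrow> real"
  assumes ab: "a \<ge> 1" "b \<ge> 1"
    and m: "filterlim m at_top sequentially"
    and le: "\<forall>\<^sub>F n in sequentially. real (m n) \<le> A n" "\<forall>\<^sub>F n in sequentially. B n > 0"
    and lim: "(\<lambda>n. A n / m n) \<longlonglongrightarrow> a" "(\<lambda>n. B n / m n) \<longlonglongrightarrow> b - 1"
    and x: "x > 0"
  shows "(\<lambda>n. root_mean (jac (m n) (A n) (B n)) (\<lambda>t. x / (x + t))) \<longlonglongrightarrow> beta_root a b x"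
proof -
  define u where "u n = root_mean (jac (m n) (A n) (B n)) (\<lambda>t. x / (x + t))" for n
  define v where "v n = root_mean (jac (m n) (A n) (B n)) (\<lambda>t. (x / (x + t))\<^sup>2)" for n
  define U where "U = beta_root a b x"
  have U: "is_beta_root a b x U" "U > 0"
    using is_beta_root_beta_root[OF ab x] by (auto simp: U_def is_beta_root_def)
  \<comment> \<open>The three summands bound the term with \<open>v\<close>, the deviation of the
    coefficient of \<open>u\<close>, and that of the constant term.\<close>
  define e where "e n = \<bar>x - 1\<bar> / m n + \<bar>1 / m n + A n / m n - a + (B n / m n + 1 - b - 2 / m n) * x\<bar>
      + x * \<bar>B n / m n + 1 - b - 1 / m n\<bar>" for n
  have m_real: "filterlim (\<lambda>n. real (m n)) at_top sequentially"
    using filterlim_compose[OF filterlim_real_sequentially m] .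
  have inv: "(\<lambda>n. c / real (m n)) \<longlonglongrightarrow> 0" for c
    by (rule tendsto_divide_0[OF tendsto_const filterlim_at_top_imp_at_infinity[OF m_real]])
  have "e \<longlonglongrightarrow> 0 + \<bar>0 + a - a + ((b - 1) + 1 - b - 0) * x\<bar> + x * \<bar>(b - 1) + 1 - b - 0\<bar>"
    unfolding e_def by (intro tendsto_intros inv lim)
  then have e0: "(\<lambda>n. e n / U) \<longlonglongrightarrow> 0" by (simp add: tendsto_divide_zero)
  have "\<forall>\<^sub>F n in sequentially. norm (u n - U) \<le> e n / U"
    using le filterlim_at_top[THEN iffD1, OF m, rule_format, of 1]
  proof eventually_elim
    case (elim n)
    note eq = jac_quadratic[OF elim(3,1,2) x, folded u_def v_def]
    have "0 \<le> x / (x + Re z) \<and> x / (x + Re z) \<le> 1"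
      if "z \<in># proots (jac (m n) (A n) (B n))" for z
      using proots_jac(2)[OF elim(1,2) that] x by simp
    then have unit: "0 \<le> u n" "u n \<le> 1" "0 \<le> v n" "v n \<le> 1"
      unfolding u_def v_def using elim(3)
      by (intro root_mean_bounds; simp add: degree_jac power_le_one)+
    define Q where "Q = x * (1 - u n) * (b - u n) - u n * (a - 1 + u n)"
    have "Q = (x - 1) * (u n)\<^sup>2 - (a - 1 + (b + 1) * x) * u n + x * b"
      by (simp add: Q_def power2_eq_square algebra_simps)
    also have "\<dots> = (x - 1) / m n * v n
      + (1 / m n + A n / m n - a + (B n / m n + 1 - b - 2 / m n) * x) * u n
      - x * (B n / m n + 1 - b - 1 / m n)"
      using eq by (simp add: algebra_simps)
    finally have Q: "Q = (x - 1) / m n * v n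
      + (1 / m n + A n / m n - a + (B n / m n + 1 - b - 2 / m n) * x) * u n
      - x * (B n / m n + 1 - b - 1 / m n)" .
    have "\<bar>Q\<bar> \<le> \<bar>x - 1\<bar> / m n * v n
      + \<bar>1 / m n + A n / m n - a + (B n / m n + 1 - b - 2 / m n) * x\<bar> * u n
      + x * \<bar>B n / m n + 1 - b - 1 / m n\<bar>"
    proof -
      have "\<bar>y1 + y2 - y3\<bar> \<le> \<bar>y1\<bar> + \<bar>y2\<bar> + \<bar>y3\<bar>" for y1 y2 y3 :: real by linarith
      from this[of "(x - 1) / m n * v n" "(1 / m n + A n / m n - a + (B n / m n + 1 - b - 2 / m n) * x) * u n"
          "x * (B n / m n + 1 - b - 1 / m n)"]
      show ?thesis unfolding Q using unit x by (simp add: abs_mult)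
    qed
    also have "\<dots> \<le> e n"
    proof -
      have "\<bar>x - 1\<bar> / m n * v n \<le> \<bar>x - 1\<bar> / m n"
        and "\<bar>y\<bar> * u n \<le> \<bar>y\<bar>" for y
        using unit by (intro mult_left_le; simp)+
      then show ?thesis unfolding e_def by (intro add_right_mono add_mono)
    qed
    finally have "\<bar>Q\<bar> \<le> e n" .
    then have "\<bar>u n - U\<bar> * U \<le> e n"
      using beta_root_stable[OF ab x U(1) unit(1,2)] by (simp add: Q_def)
    then show ?case using U(2) by (simp add: pos_le_divide_eq)
  qed
  then have "(\<lambda>n. u n - U) \<longlonglongrightarrow> 0" by (rule Lim_null_comparison) (rule e0)
  then show ?thesis by (simp add: u_def U_def LIM_zero_iff)
qed

text \<open>By tightness subsequences have limit points, and each of them has the prescribed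
  transform. The first limit point proves existence; agreement of all of them gives convergence of
  the whole sequence.\<close>

lemma weak_conv_free_beta_prime:
  fixes M :: "nat \<Rightarrow> real measure"
  assumes ab: "a \<ge> 1" "b \<ge> 1"
    and M: "\<And>n. real_distribution (M n)"
    and nn: "\<forall>\<^sub>F n in sequentially. AE t in M n. 0 \<le> t"
    and lim: "\<And>x. x > 0 \<Longrightarrow> (\<lambda>n. stieltjes (M n) x) \<longlonglongrightarrow> beta_root a b x"
  shows "real_distribution (free_beta_prime a b) \<and> weak_conv_m M (free_beta_prime a b)"
proof -
  have "tight M"
  proof (rule tightI_eventually[OF M])
    fix e :: real assume "e > 0"
    \<comment> \<open>This makes \<open>a / x\<close> equal to \<open>(e / 3)^2\<close>; the gap
      between \<open>e / 3\<close> and \<open>e / 2\<close> leaves room for a strict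
      inequality.\<close>
    define x where "x = 9 * a / e\<^sup>2"
    have "x > 0" using \<open>e > 0\<close> ab by (simp add: x_def)
    have "(1 - beta_root a b x)\<^sup>2 \<le> a / x" using ab \<open>x > 0\<close> by (rule beta_root_small)
    also have "\<dots> = (e / 3)\<^sup>2" using ab \<open>e > 0\<close> by (simp add: x_def power2_eq_square)
    finally have "1 - beta_root a b x \<le> e / 3"
      by (rule power2_le_imp_le) (use \<open>e > 0\<close> in auto)
    then have "1 - e / 2 < beta_root a b x" using \<open>e > 0\<close> by simp
    then have "\<forall>\<^sub>F n in sequentially. 1 - e / 2 < stieltjes (M n) x"
      by (rule order_tendstoD(1)[OF lim[OF \<open>x > 0\<close>]])
    then have "\<forall>\<^sub>F n in sequentially. measure (M n) {-x<..x} > 1 - e"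
      using nn
    proof eventually_elim
      case (elim n)
      interpret real_distribution "M n" by (rule M)
      \<comment> \<open>The integrand is at most \<open>1\<close> up to \<open>t = x\<close> and at
        most \<open>1/2\<close> beyond.\<close>
      have "stieltjes (M n) x \<le> (LINT t|M n. 1 / 2 + indicator {-x<..x} t / 2)"
        unfolding stieltjes_def
      proof (rule integral_mono_AE[OF integrable_stieltjes[OF elim(2) \<open>x > 0\<close>]])
        show "AE t in M n. x / (x + t) \<le> 1 / 2 + indicator {-x<..x} t / 2"
          using elim(2) by (rule eventually_mono)
            (use \<open>x > 0\<close> in \<open>auto simp: indicator_def divide_simps\<close>)
      qed (auto intro!: integrable_real_indicator simp: emeasure_eq_measure)
      also have "\<dots> = 1 / 2 + measure (M n) {-x<..x} / 2"
        using prob_space by (subst Bochner_Integration.integral_add)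
          (auto intro!: integrable_real_indicator simp: emeasure_eq_measure)
      finally show ?case using elim(1) by simp
    qed
    then show "\<exists>K. \<forall>\<^sub>F n in sequentially. measure (M n) {-K<..K} > 1 - e" by blast
  qed
  have ident: "free_beta_prime a b = \<nu>"
    if s: "strict_mono s" and \<nu>: "real_distribution \<nu>" and conv: "weak_conv_m (M \<circ> s) \<nu>" for s \<nu>
  proof -
    interpret \<nu>: real_distribution \<nu> by fact
    have Ms: "real_distribution ((M \<circ> s) n)" for n using M by simp
    have nns: "\<forall>\<^sub>F n in sequentially. AE t in M (s n). 0 \<le> t"
      using filterlim_subseq[OF s] nn by (auto simp: filterlim_iff)
    have conv_int: "(\<lambda>n. integral\<^sup>L (M (s n)) f) \<longlonglongrightarrow> integral\<^sup>L \<nu> f"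
      if "continuous_on UNIV f" "\<And>t. \<bar>f t\<bar> \<le> 1" for f :: "real \<Rightarrow> real"
      using weak_conv_imp_integral_bdd_continuous_conv[OF Ms \<nu> conv, of f 1] that
      by (simp add: continuous_on_eq_continuous_at)
    \<comment> \<open>A bounded continuous function that vanishes exactly on the nonnegative
      half-line carries the support condition over to the limit.\<close>
    define g :: "real \<Rightarrow> real" where "g t = min 1 (max 0 (- t))" for t
    have g_cont: "continuous_on UNIV g" unfolding g_def by (intro continuous_intros)
    have [measurable]: "g \<in> borel_measurable borel"
      by (rule borel_measurable_continuous_onI[OF g_cont])
    have g_bound: "0 \<le> g t" "\<bar>g t\<bar> \<le> 1" for t by (auto simp: g_def)
    have "\<forall>\<^sub>F n in sequentially. integral\<^sup>L (M (s n)) g = 0"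
      using nns
    proof eventually_elim
      case (elim n)
      interpret real_distribution "M (s n)" by (rule M)
      show ?case
        using elim by (intro integral_eq_zero_AE) (auto simp: g_def elim!: eventually_mono)
    qed
    then have "integral\<^sup>L \<nu> g = 0"
      using tendsto_cong[of "\<lambda>n. integral\<^sup>L (M (s n)) g" "\<lambda>_. 0"] conv_int[OF g_cont g_bound(2)]
      by (metis LIMSEQ_unique tendsto_const)
    moreover have "integrable \<nu> g"
      using g_bound by (intro \<nu>.integrable_const_bound[of _ 1]) auto
    ultimately have "AE t in \<nu>. g t = 0"
      using g_bound(1) by (simp add: integral_nonneg_eq_0_iff_AE)
    then have \<nu>0: "AE t in \<nu>. 0 \<le> t"
      by (rule eventually_mono) (auto simp: g_def min_def max_def split: if_splits)
    show ?thesis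
    proof (rule free_beta_prime_eqI[OF ab \<nu> \<nu>0])
      fix x :: real assume "x > 0"
      \<comment> \<open>Truncation makes the Stieltjes integrand continuous and bounded on the whole
        line without changing it for nonnegative \<open>t\<close>.\<close>
      define h where "h t = x / (x + max 0 t)" for t
      have h_cont: "continuous_on UNIV h"
        unfolding h_def using \<open>x > 0\<close> by (intro continuous_intros) (auto simp: max_def)
      have [measurable]: "h \<in> borel_measurable borel"
        by (rule borel_measurable_continuous_onI[OF h_cont])
      have h_bound: "\<bar>h t\<bar> \<le> 1" for t using \<open>x > 0\<close> by (auto simp: h_def)
      have h: "integral\<^sup>L L h = stieltjes L x"
        if "real_distribution L" "AE t in L. 0 \<le> t" for L
      proof -
        interpret L: real_distribution L by fact
        have "AE t in L. h t = x / (x + t)"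
          using that(2) by (rule eventually_mono) (simp add: h_def)
        then show ?thesis unfolding stieltjes_def by (intro integral_cong_AE) auto
      qed
      have "(\<lambda>n. integral\<^sup>L (M (s n)) h) \<longlonglongrightarrow> stieltjes \<nu> x"
        using conv_int[OF h_cont h_bound] h[OF \<nu> \<nu>0] by simp
      moreover have "\<forall>\<^sub>F n in sequentially. integral\<^sup>L (M (s n)) h = stieltjes (M (s n)) x"
        using nns by eventually_elim (rule h[OF M])
      ultimately have "(\<lambda>n. stieltjes (M (s n)) x) \<longlonglongrightarrow> stieltjes \<nu> x"
        by (rule Lim_transform_eventually)
      moreover have "(\<lambda>n. stieltjes (M (s n)) x) \<longlonglongrightarrow> beta_root a b x"
        using LIMSEQ_subseq_LIMSEQ[OF lim[OF \<open>x > 0\<close>] s] by (simp add: comp_def)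
      ultimately show "stieltjes \<nu> x = beta_root a b x" by (rule LIMSEQ_unique)
    qed
  qed
  obtain r \<nu> where "strict_mono r" "real_distribution \<nu>" "weak_conv_m (M \<circ> id \<circ> r) \<nu>"
    using tight_imp_convergent_subsubsequence[OF \<open>tight M\<close> strict_mono_id] by blast
  then have "real_distribution (free_beta_prime a b)" using ident[of r \<nu>] by simp
  moreover from this have "weak_conv_m M (free_beta_prime a b)"
    using \<open>tight M\<close> ident by (intro tight_subseq_weak_converge[OF M]) auto
  ultimately show ?thesis by simp
qed

section \<open>Both polynomial families in the common form, and their root measures\<close>

lemma hyp_poly_eq_jac: "hyp_poly n a b = jac n (a * real n) ((b - 1) * real n)"
  by (simp add: hyp_poly_def jac_def)

text \<open>With \<open>n = k + 1\<close>, absorption turns \<open>(n choose (j + 1)) / n\<close>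
  into \<open>(k choose j) / (j + 1)\<close>, and the denominator \<open>(j + 1) * fact j\<close> is
  \<open>pochhammer 2 j\<close>; hence the parameter \<open>2\<close>.\<close>

lemma hyp_poly_at_1_eq_jac:
  assumes "n \<ge> 1" "a > 0"
  shows "hyp_poly_at_1 n a = jac (n - 1) (a * real n - 1) 2"
proof -
  obtain k where n: "n = Suc k" using assms(1) by (cases n) auto
  have coeff: "real (n choose Suc j) * pochhammer (1 - a * real n) j / (real n * fact j)
      = (-1) ^ j * real (k choose j) * ((-1) ^ j * pochhammer (- (a * real n - 1)) j / pochhammer 2 j)"
    if "j \<le> k" for j
  proof -
    have 1: "real (Suc j) * real (n choose Suc j) = real n * real (k choose j)"
      using binomial_absorption[of j n] by (simp only: n diff_Suc_1 flip: of_nat_mult)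
    have 2: "pochhammer 2 j = real (Suc j) * fact j"
      using pochhammer_rec[of "1::real" j] pochhammer_fact[of "Suc j", where 'a = real] by simp
    have 3: "(-1) ^ j * ((-1) ^ j * y) = y" for y :: real
      by (simp flip: mult.assoc power_mult_distrib)
    have "real (n choose Suc j) / real n = real (k choose j) / real (Suc j)"
      using 1 n by (simp add: divide_simps mult.commute)
    then have "real (n choose Suc j) * P / (real n * fact j) = real (k choose j) * P / (real (Suc j) * fact j)" for P
      by (metis (no_types) times_divide_times_eq mult.commute times_divide_eq_left times_divide_eq_right divide_divide_eq_left)
    then show ?thesis unfolding 2 by (simp add: 3 mult.left_commute)
  qed
  have "hyp_poly_at_1 n a = (\<Sum>k=1..n. monom (complex_of_real
    (real (n choose k) * pochhammer (1 - a * real n) (k - 1) / (real n * fact (k - 1)))) (n - k))"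
    using assms by (rule hyp_poly_at_1_explicit(1))
  also have "\<dots> = (\<Sum>j\<le>k. monom (complex_of_real
    (real (n choose Suc j) * pochhammer (1 - a * real n) j / (real n * fact j))) (k - j))"
    by (rule sum.reindex_bij_witness[of _ Suc "\<lambda>i. i - 1"]) (auto simp: n)
  also have "\<dots> = jac k (a * real n - 1) 2"
    unfolding jac_def poly_of_etilde_def by (intro sum.cong refl) (simp add: coeff)
  finally show ?thesis by (simp add: n)
qed

text \<open>The image under \<open>Re\<close> makes Helly selection and weak convergence on the real
  line applicable; for real roots no information is lost.\<close>

definition real_root_distribution :: "complex poly \<Rightarrow> real measure" where
  "real_root_distribution p = distr (measure_pmf (pmf_of_multiset (proots p))) borel Re"

lemma real_distribution_real_root_distribution: "real_distribution (real_root_distribution p)"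
  unfolding real_root_distribution_def
  by (intro prob_space.real_distribution_distr prob_space_measure_pmf) simp

lemma integral_real_root_distribution:
  assumes "degree p > 0" "g \<in> borel_measurable borel"
  shows "integral\<^sup>L (real_root_distribution p) g = root_mean p g"
proof -
  have "proots p \<noteq> {#}" using assms(1) size_proots_complex[of p] by auto
  then show ?thesis
    using assms unfolding real_root_distribution_def
    by (subst integral_distr) (simp_all add: expectation_pmf_of_multiset root_mean_def size_proots_complex)
qed

lemma integral_root_distribution:
  fixes f :: "complex \<Rightarrow> real"
  assumes "degree p > 0" "\<And>z. z \<in># proots p \<Longrightarrow> z = of_real (Re z)" "continuous_on UNIV f"
  shows "integral\<^sup>L (root_distribution p) f = integral\<^sup>L (real_root_distribution p) (\<lambda>t. f (of_real t))"
proof -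
  have [measurable]: "f \<in> borel_measurable borel"
    using assms(3) by (rule borel_measurable_continuous_onI)
  have ne: "proots p \<noteq> {#}" using assms(1) size_proots_complex[of p] by auto
  have "integral\<^sup>L (root_distribution p) f = (\<Sum>z\<in>#proots p. f z) / real (degree p)"
    using ne unfolding root_distribution_def
    by (subst integral_distr) (simp_all add: expectation_pmf_of_multiset size_proots_complex)
  also have "(\<Sum>z\<in>#proots p. f z) = (\<Sum>z\<in>#proots p. f (of_real (Re z)))"
    by (intro arg_cong[where f = sum_mset] image_mset_cong) (use assms(2) in metis)
  also have "\<dots> / real (degree p) = integral\<^sup>L (real_root_distribution p) (\<lambda>t. f (of_real t))"
    by (subst integral_real_root_distribution[OF assms(1)]) (simp_all add: root_mean_def)
  finally show ?thesis .
qed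

theorem proposition3p4:
  fixes a b :: real
  assumes "a \<ge> 1" and "b \<ge> 1"
  shows "weakly_converges (\<lambda>n. root_distribution (beta_prime_poly n a b))
           (distr (free_beta_prime a b) borel complex_of_real)"
proof -
  define m where "m n = (if b = 1 then n - 1 else n)" for n :: nat
  define A where "A n = (if b = 1 then a * real n - 1 else a * real n)" for n :: nat
  define B where "B n = (if b = 1 then 2 else (b - 1) * real n)" for n :: nat
  define p where "p n = jac (m n) (A n) (B n)" for n
  define M where "M n = real_root_distribution (beta_prime_poly n a b)" for n
  \<comment> \<open>From \<open>n = 2\<close> on the degree is positive also in the case
    \<open>b = 1\<close>, where it is \<open>n - 1\<close>.\<close>
  note large = eventually_ge_at_top[of "2::nat"]
  have p: "beta_prime_poly n a b = p n" and deg: "degree (p n) > 0"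
    and le: "real (m n) \<le> A n" and B: "B n > 0" if "n \<ge> 2" for n
  proof -
    show "beta_prime_poly n a b = p n"
      using that assms by (simp add: beta_prime_poly_def p_def m_def A_def B_def hyp_poly_eq_jac hyp_poly_at_1_eq_jac)
    show "degree (p n) > 0" using that by (simp add: p_def degree_jac m_def)
    have "1 * real n \<le> a * real n" using assms by (intro mult_right_mono) auto
    then show "real (m n) \<le> A n" using that by (auto simp: m_def A_def of_nat_diff)
    show "B n > 0" using that assms by (simp add: B_def)
  qed
  have roots: "z = of_real (Re z)" "Re z > 0" if "n \<ge> 2" "z \<in># proots (p n)" for n z
    using proots_jac[OF le[OF that(1)] B[OF that(1)]] that(2) by (auto simp: p_def)
  have m_top: "filterlim m at_top sequentially"
    unfolding m_def by (cases "b = 1") (simp_all add: filterlim_ident filterlim_minus_const_nat_at_top)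
  \<comment> \<open>For \<open>b = 1\<close> these are the numerators of the corrections:
    \<open>(a n - 1) / (n - 1) = a + (a - 1) / (n - 1)\<close>, and \<open>2 / (n - 1)\<close> for
    \<open>B\<close>. For other \<open>b\<close> the ratios are exact.\<close>
  define c d where "c = (if b = 1 then a - 1 else 0)" and "d = (if b = 1 then 2 else 0 :: real)"
  have AB: "a + c / m n = A n / m n" "(b - 1) + d / m n = B n / m n" if "n \<ge> 2" for n
    using that by (auto simp: A_def B_def c_def d_def m_def of_nat_diff field_simps)
  have inv: "(\<lambda>n. y / real (m n)) \<longlonglongrightarrow> 0" for y
    by (rule tendsto_divide_0[OF tendsto_const filterlim_at_top_imp_at_infinity
          [OF filterlim_compose[OF filterlim_real_sequentially m_top]]])
  have "(\<lambda>n. a + c / m n) \<longlonglongrightarrow> a + 0" "(\<lambda>n. (b - 1) + d / m n) \<longlonglongrightarrow> (b - 1) + 0"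
    by (intro tendsto_intros inv)+
  then have "(\<lambda>n. A n / m n) \<longlonglongrightarrow> a + 0" "(\<lambda>n. B n / m n) \<longlonglongrightarrow> (b - 1) + 0"
    using AB by (blast intro: Lim_transform_eventually eventually_mono[OF large])+
  then have "(\<lambda>n. A n / m n) \<longlonglongrightarrow> a" "(\<lambda>n. B n / m n) \<longlonglongrightarrow> b - 1"
    by simp_all
  moreover have "\<forall>\<^sub>F n in sequentially. real (m n) \<le> A n" "\<forall>\<^sub>F n in sequentially. B n > 0"
    using eventually_mono[OF large le] eventually_mono[OF large B] by simp_all
  ultimately have root_mean_lim: "(\<lambda>n. root_mean (p n) (\<lambda>t. x / (x + t))) \<longlonglongrightarrow> beta_root a b x"
    if "x > 0" for x
    unfolding p_def by (intro root_mean_jac_tendsto[OF assms m_top] that)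
  have weak: "real_distribution (free_beta_prime a b) \<and> weak_conv_m M (free_beta_prime a b)"
  proof (rule weak_conv_free_beta_prime[OF assms])
    show "real_distribution (M n)" for n
      by (simp add: M_def real_distribution_real_root_distribution)
    show "\<forall>\<^sub>F n in sequentially. AE t in M n. 0 \<le> t"
      using large
    proof eventually_elim
      case (elim n)
      have "proots (p n) \<noteq> {#}" using deg[OF elim] size_proots_complex[of "p n"] by auto
      then have "AE z in measure_pmf (pmf_of_multiset (proots (p n))). 0 \<le> Re z"
        using roots(2)[OF elim] by (auto simp: AE_measure_pmf_iff intro: less_imp_le)
      then show ?case
        unfolding M_def real_root_distribution_def p[OF elim] by (subst AE_distr_iff) auto
    qed
    fix x :: real assume "x > 0"
    show "(\<lambda>n. stieltjes (M n) x) \<longlonglongrightarrow> beta_root a b x"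
    proof (rule Lim_transform_eventually[OF root_mean_lim[OF \<open>x > 0\<close>]])
      show "\<forall>\<^sub>F n in sequentially. root_mean (p n) (\<lambda>t. x / (x + t)) = stieltjes (M n) x"
        using large
        by eventually_elim (simp add: M_def p deg stieltjes_def integral_real_root_distribution)
    qed
  qed
  then interpret F: real_distribution "free_beta_prime a b" by simp
  show ?thesis unfolding weakly_converges_def
  proof (intro allI impI)
    fix f :: "complex \<Rightarrow> real"
    assume f: "continuous_on UNIV f" "bounded (range f)"
    have [measurable]: "f \<in> borel_measurable borel"
      using f(1) by (rule borel_measurable_continuous_onI)
    obtain C where C: "\<And>z. norm (f z) \<le> C" using f(2) by (auto simp: bounded_iff)
    \<comment> \<open>Restricting a test function to the real axis reduces convergence in the plane
      to convergence on the line.\<close>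
    have "continuous_on UNIV (\<lambda>t. f (of_real t))"
      by (rule continuous_on_compose2[OF f(1)]) (auto intro: continuous_intros)
    then have "(\<lambda>n. integral\<^sup>L (M n) (\<lambda>t. f (of_real t))) \<longlonglongrightarrow> integral\<^sup>L (free_beta_prime a b) (\<lambda>t. f (of_real t))"
      using weak C real_distribution_real_root_distribution
      by (intro weak_conv_imp_integral_bdd_continuous_conv[of M _ _ C])
        (auto simp: M_def continuous_on_eq_continuous_at)
    moreover have "\<forall>\<^sub>F n in sequentially. integral\<^sup>L (M n) (\<lambda>t. f (of_real t))
        = integral\<^sup>L (root_distribution (beta_prime_poly n a b)) f"
      using large
      by eventually_elim (use p deg roots(1) f(1) in \<open>simp add: M_def integral_root_distribution\<close>)
    moreover have "integral\<^sup>L (distr (free_beta_prime a b) borel complex_of_real) f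
       = integral\<^sup>L (free_beta_prime a b) (\<lambda>t. f (of_real t))"
      by (rule integral_distr) measurable
    ultimately show "(\<lambda>n. integral\<^sup>L (root_distribution (beta_prime_poly n a b)) f)
        \<longlonglongrightarrow> integral\<^sup>L (distr (free_beta_prime a b) borel complex_of_real) f"
      by (simp add: Lim_transform_eventually)
  qed
qed

end
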